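(* Consider the stochastic approximation recursion $(\xi_\ell)_{\ell\ge1}$ and value functions $v$, $v^\xi$ described in the context, and suppose: (i) the ODE $\xi'(t)=\psi(\xi(t))$ has a unique stable equilibrium point $\xi^*$; (ii) there is $C>0$ such that $\mathbb E[|\Psi(\xi_\ell;Y_{\ell+1})|^2\mid\xi_\ell]\le C(1+|\xi_\ell|^2)$ for all iterations $\ell$; (iii) there is $\kappa>0$ such that $(\xi-\xi^* )\cdot\psi(\xi)\le-\kappa|\xi-\xi^*|^2$ for all $\xi\in\mathbb R^{L_\xi}$; (iv) there are $\rho,C>0$ such that $\sup_{j\in\mathbb I_m}|v^\xi(\cdot,j)-v^{\xi^*}(\cdot,j)|_{C^0(\overline{\mathcal D})}\le C|\xi-\xi^*|^\rho$ for all $\xi\in\mathbb R^{L_\xi}$. Set $\alpha_\xi(\ell)=\frac{A}{\ell^\nu+B}$ for some $\nu\in(0,1]$, $A>\frac{\nu}{2\kappa}$ and $B>0$, and let $\epsilon>0$. Then there exists $C>0$, independent of $\ell$ and $\epsilon$, such that, for every $\ell\ge1$, with probability at least $1-\epsilon$, $$\sup_{j\in\mathbb I_m}|v^{\xi_\ell}(\cdot,j)-v(\cdot,j)|_{C^0(\overline{\mathcal D})}\le\sup_{j\in\mathbb I_m}|v(\cdot,j)-v^{\xi^*}(\cdot,j)|_{C^0(\overline{\mathcal D})}+\frac{C}{\epsilon^{\rho/2}}\ell^{-\frac{\nu\rho}{2}}.$$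
   Context: Setting: $T>0$, $\mathbb I_m=\{1,\dots,m\}$, $\overline{\mathcal D}=[0,T]\times\mathbb R^n$, $|u|_{C^0(\overline{\mathcal D})}=\sup_{\overline{\mathcal D}}|u|$. A controlled regime-switching diffusion $(X,I)$, $I$ valued in $\mathbb I_m$, satisfies $dX_s=\mu(s,X_s,I_s)ds+\sigma(s,X_s,I_s)dW_s$ with $W$ a Brownian motion, and under a feedback policy $\boldsymbol\pi=(\pi_{ij}(t,x))_{i,j\in\mathbb I_m}$ the process $I$ jumps from $i$ to $j\ne i$ with intensity $\pi_{ij}(t,X_t)$. There are a running reward $f(t,x,i)$, a terminal reward $h(x)$, switching costs $g_{ij}$ ($g_{ii}=0$), temperature $\lambda>0$ and entropy $R(\boldsymbol\pi,i)=\sum_{j\ne i}(\pi_{ij}-\pi_{ij}\log\pi_{ij})$. The function $v(t,x,i)$ is the value function (corresponding to the feedback strategy under evaluation) being approximated: the conditional expectation given $X_t=x,I_t=i$ of $\int_t^T(f(s,X_s,I_s)+\lambda R(\boldsymbol\pi(s,X_s),I_s))ds+h(X_T)$ minus the total switching costs $g_{I_{s-}I_s}$ over jump times $s\in(t,T]$ of $I$. Parametrization: $v^\xi(t,x,i)$ is a family of functions differentiable in the parameter vector $\xi\in\mathbb R^{L_\xi}$ with $v^\xi(T,x,i)=h(x)$. The parametrized policy is $\pi_{ij}^\xi(t,x)=\exp\big((v^\xi(t,x,j)-g_{ij}-v^\xi(t,x,i))/\lambda\big)$ for $j\ne i$ and $\pi_{ii}^\xi=-\sum_{j\ne i}\pi_{ij}^\xi$.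 Recursion: let $0=t_0<\dots<t_K=T$ be the uniform grid with step $\Delta t=T/K$. For a sampled trajectory $Y=(X,I,\boldsymbol\pi^\xi)$ generated under $\boldsymbol\pi^\xi$ put $$\Delta\xi_k=v^\xi(t_{k+1},X_{t_{k+1}},I_{t_{k+1}})-v^\xi(t_k,X_{t_k},I_{t_k})+\big(f(t_k,X_{t_k},I_{t_k})+\lambda R(\boldsymbol\pi^\xi(t_k,X_{t_k}),I_{t_k})\big)\Delta t-g_{I_{t_k}I_{t_{k+1}}},$$ $$\Psi(\xi;Y)=\sum_{k=0}^{K-1}\frac{\partial v^\xi}{\partial\xi}(t_k,X_{t_k},I_{t_k})\,\Delta\xi_k,\qquad \psi(\xi)=\mathbb E[\Psi(\xi;Y)].$$ Starting from an initial (deterministic) parameter $\xi_1$, the iteration is $\xi_{\ell+1}=\xi_\ell+\alpha_\xi(\ell+1)\Psi(\xi_\ell;Y_{\ell+1})$, $\ell\ge1$, where $Y_{\ell+1}=(X,I,\boldsymbol\pi^{\xi_\ell})$ is a new trajectory sampled under $\boldsymbol\pi^{\xi_\ell}$, so that $\mathbb E[\Psi(\xi_\ell;Y_{\ell+1})\mid\xi_\ell]=\psi(\xi_\ell)$. The step sizes $\alpha_\xi(\ell)>0$ are the learning rates. *)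

theory Defs
  imports "HOL-Probability.Probability"
begin

section \<open>Brownian motion and the Ito integral on a finite interval\<close>

definition filtered_space :: "'w measure \<Rightarrow> (real \<Rightarrow> 'w measure) \<Rightarrow> bool" where
  "filtered_space M F \<longleftrightarrow>
     prob_space M \<and> filtration (space M) F \<and> (\<forall>s. subalgebra M (F s))"

text \<open>A standard \<open>d\<close>-dimensional Brownian motion relative to \<open>F\<close>. Only the increments on
  \<open>[a, b]\<close> matter for stochastic integrals, so the starting value is left free.\<close>

definition brownian_motion ::
  "real \<Rightarrow> real \<Rightarrow> 'w measure \<Rightarrow> (real \<Rightarrow> 'w measure) \<Rightarrow> (real \<Rightarrow> 'w \<Rightarrow> real ^ 'd) \<Rightarrow> bool" where
  "brownian_motion a b M F W \<longleftrightarrow>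
     (\<forall>s\<in>{a..b}. W s \<in> borel_measurable (F s)) \<and>
     (\<forall>\<omega>\<in>space M. continuous_on {a..b} (\<lambda>s. W s \<omega>)) \<and>
     (\<forall>s u. a \<le> s \<longrightarrow> s < u \<longrightarrow> u \<le> b \<longrightarrow>
        prob_space.indep_set M (sets (F s))
          {(\<lambda>\<omega>. W u \<omega> - W s \<omega>) -` B \<inter> space M | B. B \<in> sets borel} \<and>
        prob_space.indep_vars M (\<lambda>_. borel) (\<lambda>k \<omega>. (W u \<omega> - W s \<omega>) $ k) UNIV \<and>
        (\<forall>k. distributed M lborel (\<lambda>\<omega>. (W u \<omega> - W s \<omega>) $ k)
               (\<lambda>y. ennreal (normal_density 0 (sqrt (u - s)) y))))"

definition vanishes_in_probability :: "'w measure \<Rightarrow> (nat \<Rightarrow> 'w \<Rightarrow> ennreal) \<Rightarrow> bool" where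
  "vanishes_in_probability M Z \<longleftrightarrow>
     (\<forall>e>0. (\<lambda>k. measure M {\<omega> \<in> space M. ennreal e < Z k \<omega>}) \<longlonglongrightarrow> 0)"

text \<open>A simple integrand takes the matrix value \<open>\<eta> j\<close> on the \<open>j\<close>-th interval \<open>(\<tau> j, \<tau> (j+1)]\<close>.\<close>

definition simple_integrand ::
  "real \<Rightarrow> real \<Rightarrow> (real \<Rightarrow> 'w measure) \<Rightarrow> nat \<Rightarrow> (nat \<Rightarrow> real) \<Rightarrow>
   (nat \<Rightarrow> 'w \<Rightarrow> real ^ 'd ^ 'n) \<Rightarrow> bool" where
  "simple_integrand a b F p \<tau> \<eta> \<longleftrightarrow>
     a \<le> \<tau> 0 \<and> \<tau> p \<le> b \<and>
     (\<forall>j<p. \<tau> j \<le> \<tau> (Suc j) \<and> \<eta> j \<in> borel_measurable (F (\<tau> j)) \<and>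
            (\<exists>B. \<forall>\<omega>\<in>space (F (\<tau> j)). norm (\<eta> j \<omega>) \<le> B))"

definition simple_value ::
  "nat \<Rightarrow> (nat \<Rightarrow> real) \<Rightarrow> (nat \<Rightarrow> 'w \<Rightarrow> real ^ 'd ^ 'n) \<Rightarrow> real \<Rightarrow> 'w \<Rightarrow> real ^ 'd ^ 'n" where
  "simple_value p \<tau> \<eta> s \<omega> = (\<Sum>j<p. indicator {\<tau> j<..\<tau> (Suc j)} s *\<^sub>R \<eta> j \<omega>)"

definition simple_integral ::
  "nat \<Rightarrow> (nat \<Rightarrow> real) \<Rightarrow> (nat \<Rightarrow> 'w \<Rightarrow> real ^ 'd ^ 'n) \<Rightarrow> (real \<Rightarrow> 'w \<Rightarrow> real ^ 'd) \<Rightarrow>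
   'w \<Rightarrow> real ^ 'n" where
  "simple_integral p \<tau> \<eta> W \<omega> = (\<Sum>j<p. \<eta> j \<omega> *v (W (\<tau> (Suc j)) \<omega> - W (\<tau> j) \<omega>))"

text \<open>\<open>J\<close> is (a version of) the Ito integral of \<open>H\<close> against \<open>W\<close> over \<open>[a, b]\<close>: there are simple
  adapted integrands converging to \<open>H\<close> in \<open>L\<^sup>2(ds)\<close>, in probability, whose integrals
  converge to \<open>J\<close> in probability.\<close>

definition ito_integral ::
  "real \<Rightarrow> real \<Rightarrow> 'w measure \<Rightarrow> (real \<Rightarrow> 'w measure) \<Rightarrow> (real \<Rightarrow> 'w \<Rightarrow> real ^ 'd) \<Rightarrow>
   (real \<Rightarrow> 'w \<Rightarrow> real ^ 'd ^ 'n) \<Rightarrow> ('w \<Rightarrow> real ^ 'n) \<Rightarrow> bool" where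
  "ito_integral a b M F W H J \<longleftrightarrow>
     (\<lambda>(s, \<omega>). H s \<omega>) \<in> borel_measurable (restrict_space borel {a..b} \<Otimes>\<^sub>M M) \<and>
     J \<in> borel_measurable M \<and>
     (\<exists>p \<tau> \<eta>.
        (\<forall>k. simple_integrand a b F (p k) (\<tau> k) (\<eta> k)) \<and>
        vanishes_in_probability M
          (\<lambda>k \<omega>. \<integral>\<^sup>+s\<in>{a..b}. ennreal ((norm (simple_value (p k) (\<tau> k) (\<eta> k) s \<omega> - H s \<omega>))\<^sup>2) \<partial>lborel) \<and>
        vanishes_in_probability M
          (\<lambda>k \<omega>. ennreal (norm (simple_integral (p k) (\<tau> k) (\<eta> k) W \<omega> - J \<omega>))))"

section \<open>Controlled regime-switching diffusions\<close>

text \<open>Regimes form a finite type \<open>'m\<close> carrying the discrete topology. A regime path is a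
  piecewise constant cadlag function.\<close>

definition left_regime :: "(real \<Rightarrow> 'm) \<Rightarrow> real \<Rightarrow> 'm" where
  "left_regime \<iota> s = (THE i. eventually (\<lambda>r. \<iota> r = i) (at_left s))"

definition cadlag_regime :: "real \<Rightarrow> real \<Rightarrow> (real \<Rightarrow> 'm) \<Rightarrow> bool" where
  "cadlag_regime a b \<iota> \<longleftrightarrow>
     (\<forall>s\<in>{a..<b}. eventually (\<lambda>r. \<iota> r = \<iota> s) (at_right s)) \<and>
     (\<forall>s\<in>{a<..b}. \<exists>i. eventually (\<lambda>r. \<iota> r = i) (at_left s))"

definition jump_times :: "real \<Rightarrow> real \<Rightarrow> (real \<Rightarrow> 'm) \<Rightarrow> real set" where
  "jump_times a b \<iota> = {s\<in>{a<..b}. left_regime \<iota> s \<noteq> \<iota> s}"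

text \<open>The predictable \<open>\<sigma>\<close>-algebra on \<open>(a, b] \<times> \<Omega>\<close>.\<close>

definition predictable :: "real \<Rightarrow> real \<Rightarrow> 'w measure \<Rightarrow> (real \<Rightarrow> 'w measure) \<Rightarrow> (real \<times> 'w) measure" where
  "predictable a b M F = sigma ({a<..b} \<times> space M)
     {{s<..u} \<times> A | s u A. a \<le> s \<and> s \<le> u \<and> u \<le> b \<and> A \<in> sets (F s)}"

text \<open>The regime process \<open>I\<close> jumps from \<open>i\<close> to \<open>j\<close> with stochastic intensity \<open>q s \<omega> i j\<close>
  (Bremaud's definition): for every nonnegative predictable \<open>C\<close>, the expected sum of \<open>C\<close>
  over the jumps from \<open>i\<close> to \<open>j\<close> equals the expected time integral of \<open>C\<close> against the
  intensity while \<open>I\<close> sits in \<open>i\<close>.\<close>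

definition jump_intensity ::
  "real \<Rightarrow> real \<Rightarrow> 'w measure \<Rightarrow> (real \<Rightarrow> 'w measure) \<Rightarrow> (real \<Rightarrow> 'w \<Rightarrow> 'm) \<Rightarrow>
   (real \<Rightarrow> 'w \<Rightarrow> 'm \<Rightarrow> 'm \<Rightarrow> real) \<Rightarrow> bool" where
  "jump_intensity a b M F I q \<longleftrightarrow>
     (\<forall>i j. i \<noteq> j \<longrightarrow> (\<forall>C\<in>borel_measurable (predictable a b M F).
        (\<integral>\<^sup>+\<omega>. (\<integral>\<^sup>+s. C (s, \<omega>) \<partial>count_space
            {s\<in>jump_times a b (\<lambda>r. I r \<omega>). left_regime (\<lambda>r. I r \<omega>) s = i \<and> I s \<omega> = j}) \<partial>M)
        = (\<integral>\<^sup>+\<omega>. (\<integral>\<^sup>+s\<in>{a<..b}. C (s, \<omega>) * (if I s \<omega> = i then ennreal (q s \<omega> i j) else 0)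
            \<partial>lborel) \<partial>M)))"

text \<open>A weak solution: the stochastic basis together with the driving Brownian motion, the
  state and the regime process.\<close>

record ('w, 'd, 'n, 'm) weak_solution =
  basis :: "'w measure"
  filt :: "real \<Rightarrow> 'w measure"
  noise :: "real \<Rightarrow> 'w \<Rightarrow> real ^ 'd"
  state :: "real \<Rightarrow> 'w \<Rightarrow> real ^ 'n"
  regime :: "real \<Rightarrow> 'w \<Rightarrow> 'm"

text \<open>\<open>regime_diffusion a b \<mu> \<sigma> \<pi> \<nu> S\<close>: on \<open>[a, b]\<close>, the pair of processes in \<open>S\<close> solves
  \<open>dX = \<mu>(s, X, I) ds + \<sigma>(s, X, I) dW\<close>, the regime jumps from \<open>i\<close> to \<open>j\<close> with intensity
  \<open>\<pi> s (X s) i j\<close>, and \<open>\<nu>\<close> is the law of \<open>(X a, I a)\<close>.\<close>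

definition regime_diffusion ::
  "real \<Rightarrow> real \<Rightarrow> (real \<Rightarrow> real ^ 'n \<Rightarrow> 'm \<Rightarrow> real ^ 'n) \<Rightarrow> (real \<Rightarrow> real ^ 'n \<Rightarrow> 'm \<Rightarrow> real ^ 'd ^ 'n) \<Rightarrow>
   (real \<Rightarrow> real ^ 'n \<Rightarrow> 'm \<Rightarrow> 'm \<Rightarrow> real) \<Rightarrow> ((real ^ 'n) \<times> 'm) measure \<Rightarrow>
   ('w, 'd::finite, 'n::finite, 'm::finite) weak_solution \<Rightarrow> bool" where
  "regime_diffusion a b \<mu> \<sigma> \<pi> \<nu> S \<longleftrightarrow>
     (let M = basis S; F = filt S; W = noise S; X = state S; I = regime S in
      filtered_space M F \<and>
      brownian_motion a b M F W \<and>
      (\<forall>s\<in>{a..b}. X s \<in> borel_measurable (F s) \<and> I s \<in> measurable (F s) (count_space UNIV)) \<and>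
      (\<forall>\<omega>\<in>space M. continuous_on {a..b} (\<lambda>s. X s \<omega>) \<and> cadlag_regime a b (\<lambda>s. I s \<omega>)) \<and>
      distr M (borel \<Otimes>\<^sub>M count_space UNIV) (\<lambda>\<omega>. (X a \<omega>, I a \<omega>)) = \<nu> \<and>
      (AE \<omega> in M. set_integrable lborel {a..b} (\<lambda>s. \<mu> s (X s \<omega>) (I s \<omega>))) \<and>
      (\<forall>u\<in>{a..b}. \<exists>J. ito_integral a u M F W (\<lambda>s \<omega>. \<sigma> s (X s \<omega>) (I s \<omega>)) J \<and>
         (AE \<omega> in M. X u \<omega> = X a \<omega> + (LINT s:{a..u}|lborel. \<mu> s (X s \<omega>) (I s \<omega>)) + J \<omega>)) \<and>
      jump_intensity a b M F I (\<lambda>s \<omega> i j. \<pi> s (X s \<omega>) i j))"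

section \<open>Policies, entropy and the value function\<close>

definition feedback_policy :: "real \<Rightarrow> (real \<Rightarrow> real ^ 'n \<Rightarrow> 'm::finite \<Rightarrow> 'm \<Rightarrow> real) \<Rightarrow> bool" where
  "feedback_policy T \<pi> \<longleftrightarrow>
     (\<forall>i j. (\<lambda>(t, x). \<pi> t x i j) \<in> borel_measurable (restrict_space borel ({0..T} \<times> UNIV))) \<and>
     (\<forall>t\<in>{0..T}. \<forall>x i j. i \<noteq> j \<longrightarrow> 0 \<le> \<pi> t x i j) \<and>
     (\<forall>t\<in>{0..T}. \<forall>x i. \<pi> t x i i = - (\<Sum>j\<in>UNIV - {i}. \<pi> t x i j))"

text \<open>With \<open>ln 0 = 0\<close> the summand is \<open>0\<close> at intensity \<open>0\<close>, the usual convention.\<close>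

definition entropy :: "('m::finite \<Rightarrow> 'm \<Rightarrow> real) \<Rightarrow> 'm \<Rightarrow> real" where
  "entropy q i = (\<Sum>j\<in>UNIV - {i}. q i j - q i j * ln (q i j))"

definition payoff ::
  "real \<Rightarrow> (real \<Rightarrow> real ^ 'n \<Rightarrow> 'm::finite \<Rightarrow> real) \<Rightarrow> (real ^ 'n \<Rightarrow> real) \<Rightarrow> ('m \<Rightarrow> 'm \<Rightarrow> real) \<Rightarrow> real \<Rightarrow>
   (real \<Rightarrow> real ^ 'n \<Rightarrow> 'm \<Rightarrow> 'm \<Rightarrow> real) \<Rightarrow> real \<Rightarrow> (real \<Rightarrow> real ^ 'n) \<Rightarrow> (real \<Rightarrow> 'm) \<Rightarrow> real" where
  "payoff T f h g lam \<pi> t x \<iota> =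
     (LINT s:{t..T}|lborel. f s (x s) (\<iota> s) + lam * entropy (\<pi> s (x s)) (\<iota> s))
     + h (x T) - (\<Sum>s\<in>jump_times t T \<iota>. g (left_regime \<iota> s) (\<iota> s))"

text \<open>\<open>v\<close> is the value function of the policy \<open>\<pi>\<close>. The conditional expectation given
  \<open>X\<^sub>t = x\<close>, \<open>I\<^sub>t = i\<close> is the expectation under the diffusion \<open>S t x i\<close> started
  from \<open>(x, i)\<close> at time \<open>t\<close>, so that \<open>v\<close> is determined at every point.\<close>

definition is_value_function ::
  "real \<Rightarrow> (real \<Rightarrow> real ^ 'n \<Rightarrow> 'm \<Rightarrow> real ^ 'n) \<Rightarrow> (real \<Rightarrow> real ^ 'n \<Rightarrow> 'm \<Rightarrow> real ^ 'd ^ 'n) \<Rightarrow>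
   (real \<Rightarrow> real ^ 'n \<Rightarrow> 'm \<Rightarrow> real) \<Rightarrow> (real ^ 'n \<Rightarrow> real) \<Rightarrow> ('m \<Rightarrow> 'm \<Rightarrow> real) \<Rightarrow> real \<Rightarrow>
   (real \<Rightarrow> real ^ 'n \<Rightarrow> 'm \<Rightarrow> 'm \<Rightarrow> real) \<Rightarrow>
   (real \<Rightarrow> real ^ 'n \<Rightarrow> 'm \<Rightarrow> ('w, 'd::finite, 'n::finite, 'm::finite) weak_solution) \<Rightarrow>
   (real \<Rightarrow> real ^ 'n \<Rightarrow> 'm \<Rightarrow> real) \<Rightarrow> bool" where
  "is_value_function T \<mu> \<sigma> f h g lam \<pi> S v \<longleftrightarrow>
     (\<forall>t\<in>{0..T}. \<forall>x i.
        (let M = basis (S t x i); X = state (S t x i); I = regime (S t x i);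
             G = (\<lambda>\<omega>. payoff T f h g lam \<pi> t (\<lambda>s. X s \<omega>) (\<lambda>s. I s \<omega>)) in
         regime_diffusion t T \<mu> \<sigma> \<pi> (return (borel \<Otimes>\<^sub>M count_space UNIV) (x, i)) (S t x i) \<and>
         (AE \<omega> in M. set_integrable lborel {t..T}
            (\<lambda>s. f s (X s \<omega>) (I s \<omega>) + lam * entropy (\<pi> s (X s \<omega>)) (I s \<omega>))) \<and>
         integrable M G \<and>
         v t x i = (\<integral>\<omega>. G \<omega> \<partial>M)))"

text \<open>The norm of \<open>C\<^sup>0([0,T] \<times> \<real>\<^sup>n)\<close>, possibly infinite.\<close>

definition sup_norm :: "real \<Rightarrow> (real \<Rightarrow> real ^ 'n \<Rightarrow> real) \<Rightarrow> ennreal" where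
  "sup_norm T u = (SUP (t, x)\<in>{0..T} \<times> UNIV. ennreal \<bar>u t x\<bar>)"

section \<open>Parametrization and temporal differences\<close>

text \<open>Throughout, \<open>V \<xi> t x i\<close> is the parametrized value function.\<close>

definition parametrized_policy ::
  "(real ^ 'l \<Rightarrow> real \<Rightarrow> real ^ 'n \<Rightarrow> 'm::finite \<Rightarrow> real) \<Rightarrow> ('m \<Rightarrow> 'm \<Rightarrow> real) \<Rightarrow> real \<Rightarrow> real ^ 'l \<Rightarrow>
   real \<Rightarrow> real ^ 'n \<Rightarrow> 'm \<Rightarrow> 'm \<Rightarrow> real" where
  "parametrized_policy V g lam \<xi> t x i j =
     (if j \<noteq> i then exp ((V \<xi> t x j - g i j - V \<xi> t x i) / lam)
      else - (\<Sum>k\<in>UNIV - {i}. exp ((V \<xi> t x k - g i k - V \<xi> t x i) / lam)))"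

definition param_gradient ::
  "(real ^ 'l \<Rightarrow> real \<Rightarrow> real ^ 'n \<Rightarrow> 'm \<Rightarrow> real) \<Rightarrow> real ^ 'l \<Rightarrow> real \<Rightarrow> real ^ 'n \<Rightarrow> 'm \<Rightarrow> real ^ 'l" where
  "param_gradient V \<xi> t x i = (THE D. GDERIV (\<lambda>\<zeta>. V \<zeta> t x i) \<xi> :> D)"

definition grid_time :: "real \<Rightarrow> nat \<Rightarrow> nat \<Rightarrow> real" where
  "grid_time T K k = real k * T / real K"

type_synonym ('n, 'm) path = "real \<Rightarrow> (real ^ 'n) \<times> 'm"

definition path_space :: "real \<Rightarrow> ('n::finite, 'm) path measure" where
  "path_space T = (\<Pi>\<^sub>M s\<in>{0..T}. borel \<Otimes>\<^sub>M count_space UNIV)"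

definition trajectory_law :: "real \<Rightarrow> ('w, 'd::finite, 'n::finite, 'm) weak_solution \<Rightarrow> ('n, 'm) path measure" where
  "trajectory_law T S =
     distr (basis S) (path_space T) (\<lambda>\<omega>. \<lambda>s\<in>{0..T}. (state S s \<omega>, regime S s \<omega>))"

definition temporal_difference ::
  "real \<Rightarrow> nat \<Rightarrow> (real \<Rightarrow> real ^ 'n \<Rightarrow> 'm::finite \<Rightarrow> real) \<Rightarrow> ('m \<Rightarrow> 'm \<Rightarrow> real) \<Rightarrow> real \<Rightarrow>
   (real ^ 'l \<Rightarrow> real \<Rightarrow> real ^ 'n \<Rightarrow> 'm \<Rightarrow> real) \<Rightarrow> real ^ 'l \<Rightarrow> ('n, 'm) path \<Rightarrow> nat \<Rightarrow> real" where
  "temporal_difference T K f g lam V \<xi> y k =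
     (let t = grid_time T K k; t' = grid_time T K (Suc k); (x, i) = y t; (x', i') = y t' in
      V \<xi> t' x' i' - V \<xi> t x i
      + (f t x i + lam * entropy (parametrized_policy V g lam \<xi> t x) i) * (T / real K) - g i i')"

definition Psi ::
  "real \<Rightarrow> nat \<Rightarrow> (real \<Rightarrow> real ^ 'n \<Rightarrow> 'm::finite \<Rightarrow> real) \<Rightarrow> ('m \<Rightarrow> 'm \<Rightarrow> real) \<Rightarrow> real \<Rightarrow>
   (real ^ 'l \<Rightarrow> real \<Rightarrow> real ^ 'n \<Rightarrow> 'm \<Rightarrow> real) \<Rightarrow> real ^ 'l \<Rightarrow> ('n, 'm) path \<Rightarrow> real ^ 'l" where
  "Psi T K f g lam V \<xi> y =
     (\<Sum>k<K. temporal_difference T K f g lam V \<xi> y k *\<^sub>R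
        (let t = grid_time T K k; (x, i) = y t in param_gradient V \<xi> t x i))"

section \<open>Stochastic approximation\<close>

text \<open>The information generated by the first \<open>l\<close> iterates: \<open>\<xi>\<^sub>1\<close> is deterministic, so it is
  generated by the trajectories sampled so far.\<close>

definition history :: "'w measure \<Rightarrow> real \<Rightarrow> (nat \<Rightarrow> 'w \<Rightarrow> ('n::finite, 'm) path) \<Rightarrow> nat \<Rightarrow> 'w measure" where
  "history M T Y l =
     sigma (space M) (\<Union>k\<in>{2..l}. {Y k -` B \<inter> space M | B. B \<in> sets (path_space T)})"

text \<open>Given the past, the new trajectory \<open>Y (l+1)\<close> is distributed according to \<open>L (\<xi> l)\<close>,
  where \<open>L \<zeta>\<close> is the law of the trajectory generated under the parameter \<open>\<zeta>\<close>.\<close>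

definition samples_trajectories ::
  "'w measure \<Rightarrow> real \<Rightarrow> (real ^ 'l \<Rightarrow> ('n::finite, 'm) path measure) \<Rightarrow> (nat \<Rightarrow> 'w \<Rightarrow> real ^ 'l) \<Rightarrow>
   (nat \<Rightarrow> 'w \<Rightarrow> ('n, 'm) path) \<Rightarrow> bool" where
  "samples_trajectories M T L \<xi> Y \<longleftrightarrow>
     (\<forall>l\<ge>1. Y (Suc l) \<in> measurable M (path_space T) \<and>
        (\<forall>B\<in>sets (path_space T). AE \<omega> in M.
           real_cond_exp M (history M T Y l) (indicator (Y (Suc l) -` B \<inter> space M)) \<omega>
           = measure (L (\<xi> l \<omega>)) B))"

text \<open>Lyapunov stability; solutions are quantified over all intervals \<open>[0, \<tau>)\<close> so that no
  global existence is presupposed.\<close>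

definition stable_equilibrium :: "('a::real_normed_vector \<Rightarrow> 'a) \<Rightarrow> 'a \<Rightarrow> bool" where
  "stable_equilibrium \<psi> z \<longleftrightarrow>
     \<psi> z = 0 \<and>
     (\<forall>e>0. \<exists>d>0. \<forall>\<tau>>0. \<forall>y.
        (\<forall>t\<in>{0..<\<tau>}. (y has_vector_derivative \<psi> (y t)) (at t within {0..<\<tau>})) \<longrightarrow>
        dist (y 0) z < d \<longrightarrow> (\<forall>t\<in>{0..<\<tau>}. dist (y t) z < e))"

end

theory Submission
  imports Defs "HOL-Real_Asymp.Real_Asymp"
begin

text \<open>Let \<open>a\<^sub>l\<close> be the mean of \<open>\<bar>\<xi>\<^sub>l - \<xi>\<^sup>*\<bar>\<^sup>2\<close>. Expanding the square of one step of the recursion gives three terms.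
The cross term is controlled by the dissipativity of \<open>\<psi>\<close>: conditionally on the past the increment has mean
\<open>\<psi>(\<xi>\<^sub>l)\<close>, so the term is at most \<open>-2 \<kappa> \<alpha>\<^sub>l\<^sub>+\<^sub>1 a\<^sub>l\<close>. The square of the increment is controlled by the bound on its
conditional second moment. Hence, with a constant \<open>C'\<close>,

\<open>a\<^sub>l\<^sub>+\<^sub>1 \<le> (1 - 2 \<kappa> \<alpha>\<^sub>l\<^sub>+\<^sub>1 + C' \<alpha>\<^sub>l\<^sub>+\<^sub>1\<^sup>2) a\<^sub>l + C' \<alpha>\<^sub>l\<^sub>+\<^sub>1\<^sup>2\<close>,

and the condition \<open>2 \<kappa> A > \<nu>\<close> makes the gain \<open>2 \<kappa> \<alpha>\<^sub>l\<^sub>+\<^sub>1\<close> beat the relative decay of \<open>l\<^sup>-\<^sup>\<nu>\<close>, so that \<open>a\<^sub>l \<le> D l\<^sup>-\<^sup>\<nu>\<close>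
(\<open>recursion_powr_rate\<close>, \<open>robbins_monro_mean_square_rate\<close>). Markov's inequality yields
\<open>\<bar>\<xi>\<^sub>l - \<xi>\<^sup>*\<bar>\<^sup>2 < D l\<^sup>-\<^sup>\<nu> / \<epsilon>\<close> with probability at least \<open>1 - \<epsilon>\<close>, and the Hoelder condition on the parametrization
together with the triangle inequality for the supremum norm turns this into the claim.

Three measure-theoretic points carry the rest. First, the sampling hypothesis speaks of one event of path
space at a time, with an exceptional null set depending on the event, and the laws of the trajectories form an arbitrary family
indexed by the parameter; a monotone class argument extends it to the conditional mean of every jointly
measurable function of the iterate and the new trajectory (\<open>nn_integral_disintegration\<close>).
Second, the increment is jointly measurable in parameter and path because the parametrized value function is
continuous in the parameter and measurable in the state (\<open>borel_measurable_Psi\<close>). Third, the event in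
the conclusion is an uncountable intersection, but it is the preimage under \<open>\<xi>\<^sub>l\<close> of a set of parameters
that is closed by continuity (\<open>closed_sup_norm_le\<close>).\<close>

section \<open>A recursive inequality with polynomially decaying steps\<close>

text \<open>For \<open>\<nu> \<le> 1\<close> the weighted inequality of arithmetic and geometric means gives
\<open>(1 + 1/l)\<^sup>\<nu> \<le> 1 + \<nu>/l\<close>, and \<open>l\<^sup>\<nu>\<^sup>-\<^sup>1 \<le> 1\<close>. This makes the variable \<open>q = l\<^sup>\<nu>\<close> grow by at most \<open>\<nu>\<close> per step.\<close>

lemma powr_Suc_le_add:
  assumes "0 < \<nu>" "\<nu> \<le> 1" "l \<ge> (1::nat)"
  shows "real (Suc l) powr \<nu> \<le> real l powr \<nu> + \<nu>"
proof -
  have l: "real l > 0" using assms by simp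
  have "real (Suc l) powr \<nu> = real l powr \<nu> * (1 + 1 / l) powr \<nu>"
    using l by (subst powr_mult[symmetric]) (auto simp: distrib_left add.commute)
  also have "(1 + 1 / l) powr \<nu> \<le> 1 + \<nu> * (1 / l)"
  proof -
    have "(1 + 1 / real l) powr \<nu> * 1 powr (1 - \<nu>) \<le> \<nu> * (1 + 1 / real l) + (1 - \<nu>) * 1"
      using assms by (intro Youngs_inequality_0) (auto intro: add_pos_nonneg)
    then show ?thesis by (simp add: algebra_simps)
  qed
  also have "real l powr \<nu> * (1 + \<nu> * (1 / l)) = real l powr \<nu> + \<nu> * real l powr (\<nu> - 1)"
    using l by (simp add: powr_diff algebra_simps)
  also have "real l powr (\<nu> - 1) \<le> 1"
    using assms by (simp add: powr_mono[of "\<nu> - 1" 0 "real l", simplified])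
  finally show ?thesis using assms by simp
qed

text \<open>The induction step of the rate, in the variable \<open>q = l\<^sup>\<nu>\<close>. The value \<open>D/q\<close> may drop to \<open>D/(q + \<nu>)\<close> only, which
after multiplication by \<open>q\<^sup>2\<close> costs about \<open>\<nu> D\<close>; the contraction gains about \<open>2 \<kappa> A D\<close>. The
strict inequality \<open>2 \<kappa> A > \<nu>\<close> leaves a surplus \<open>\<delta> D\<close> for large \<open>q\<close>, which absorbs the noise \<open>C A\<^sup>2\<close> once
\<open>D\<close> is large. The threshold for \<open>q\<close> does not depend on \<open>D\<close>, so that \<open>D\<close> may be enlarged afterwards
to cover the finitely many early indices.\<close>

lemma rate_comparison_eventually:
  fixes A B C \<kappa> \<nu> :: real
  assumes "0 < \<nu>" "0 < \<kappa>" "A > \<nu> / (2 * \<kappa>)" "0 < B" "0 \<le> C"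
  obtains q0 D0 where "0 < q0" "0 < D0"
    "\<And>q \<alpha> D. \<lbrakk>q0 \<le> q; D0 \<le> D; A / (q + \<nu> + B) \<le> \<alpha>; \<alpha> \<le> A / q\<rbrakk> \<Longrightarrow>
       0 \<le> 1 - 2 * \<kappa> * \<alpha> + C * \<alpha>\<^sup>2 \<and>
       (1 - 2 * \<kappa> * \<alpha> + C * \<alpha>\<^sup>2) * (D / q) + C * \<alpha>\<^sup>2 \<le> D / (q + \<nu>)"
proof -
  \<comment> \<open>Half of the limit of the balance below, so that the balance eventually exceeds it.\<close>
  define \<delta> where "\<delta> = (2 * \<kappa> * A - \<nu>) / 2"
  have "\<nu> < A * (2 * \<kappa>)"
    using assms(2,3) by (metis mult_pos_pos pos_divide_less_eq zero_less_numeral)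
  then have \<delta>: "\<delta> > 0" unfolding \<delta>_def by argo
  have A: "A > 0" using assms by (meson divide_pos_pos less_trans mult_pos_pos zero_less_numeral)
  have lim: "((\<lambda>q::real. q / (q + c)) \<longlongrightarrow> 1) at_top" for c
    by real_asymp
  have "((\<lambda>q. 2 * \<kappa> * A * (q / (q + (\<nu> + B))) - \<nu> * (q / (q + \<nu>)) - C * A\<^sup>2 / q)
      \<longlongrightarrow> 2 * \<kappa> * A * 1 - \<nu> * 1 - 0) at_top"
    by (intro tendsto_intros lim tendsto_divide_0[OF tendsto_const] filterlim_at_top_imp_at_infinity
        filterlim_ident)
  then have "eventually (\<lambda>q. 2 * \<kappa> * A * (q / (q + (\<nu> + B))) - \<nu> * (q / (q + \<nu>)) - C * A\<^sup>2 / q > \<delta>) at_top"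
    by (rule order_tendstoD) (use \<delta> in \<open>unfold \<delta>_def, argo\<close>)
  then obtain q1 where q1: "\<And>q. q \<ge> q1 \<Longrightarrow>
      2 * \<kappa> * A * (q / (q + (\<nu> + B))) - \<nu> * (q / (q + \<nu>)) - C * A\<^sup>2 / q > \<delta>"
    by (auto simp: eventually_at_top_linorder)
  show ?thesis
  \<comment> \<open>The bound \<open>q \<ge> 2 \<kappa> A\<close> keeps the contraction factor nonnegative.\<close>
  proof (rule that[of "max (max q1 1) (2 * \<kappa> * A)" "C * A\<^sup>2 / \<delta> + 1"])
    fix q \<alpha> D :: real
    assume q: "max (max q1 1) (2 * \<kappa> * A) \<le> q" and D: "C * A\<^sup>2 / \<delta> + 1 \<le> D"
      and \<alpha>: "A / (q + \<nu> + B) \<le> \<alpha>" "\<alpha> \<le> A / q"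
    have q0: "q > 0" "q \<ge> q1" using q by auto
    have \<alpha>0: "\<alpha> > 0" using \<alpha> A q0 assms by (smt (verit) divide_pos_pos)
    have D0: "D > 0" "C * A\<^sup>2 \<le> \<delta> * D" using D \<delta> \<open>0 \<le> C\<close>
      by (smt (verit) divide_nonneg_pos mult_nonneg_nonneg zero_le_power2)
         (use D \<delta> in \<open>simp add: field_simps\<close>)
    have "2 * \<kappa> * \<alpha> \<le> 2 * \<kappa> * (A / q)" using \<alpha> assms by (intro mult_left_mono) auto
    also have "\<dots> \<le> 1" using q q0 by (simp add: field_simps)
    finally have "0 \<le> 1 - 2 * \<kappa> * \<alpha> + C * \<alpha>\<^sup>2" using assms by simp
    moreover have "(1 - 2 * \<kappa> * \<alpha> + C * \<alpha>\<^sup>2) * (D / q) + C * \<alpha>\<^sup>2 \<le> D / (q + \<nu>)"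
    proof -
      have sq: "C * \<alpha>\<^sup>2 \<le> C * (A\<^sup>2 / q\<^sup>2)"
        using \<alpha> \<alpha>0 \<open>0 \<le> C\<close> by (intro mult_left_mono) (auto simp flip: power_divide intro: power_mono)
      have low: "2 * \<kappa> * (A / (q + \<nu> + B)) \<le> 2 * \<kappa> * \<alpha>" using \<alpha> assms by (intro mult_left_mono) auto
      have "(1 - 2 * \<kappa> * \<alpha> + C * \<alpha>\<^sup>2) * (D / q) + C * \<alpha>\<^sup>2
          \<le> (1 - 2 * \<kappa> * (A / (q + \<nu> + B)) + C * (A\<^sup>2 / q\<^sup>2)) * (D / q) + C * (A\<^sup>2 / q\<^sup>2)"
        using sq low D0 q0 by (intro add_mono mult_right_mono) auto
      also have "\<dots> = D / (q + \<nu>) - (D * (2 * \<kappa> * A * (q / (q + (\<nu> + B))) - \<nu> * (q / (q + \<nu>)) - C * A\<^sup>2 / q) - C * A\<^sup>2) / q\<^sup>2"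
      proof -
        \<comment> \<open>Both sides are polynomials in \<open>x\<close>, \<open>y\<close> and \<open>1/q\<close>.\<close>
        define x y where "x = q / (q + (\<nu> + B))" and "y = q / (q + \<nu>)"
        have nz: "q \<noteq> 0" "q + (\<nu> + B) \<noteq> 0" "q + \<nu> \<noteq> 0" using q0 assms by auto
        have eA: "A / (q + \<nu> + B) = A * x / q" using nz by (simp add: x_def add.assoc)
        have eD: "D / (q + \<nu>) = D / q - D * \<nu> * y / q\<^sup>2"
          using nz by (simp add: y_def divide_simps power2_eq_square) algebra
        show ?thesis
          unfolding x_def[symmetric] y_def[symmetric] eA eD using nz(1)
          by (simp add: divide_simps power2_eq_square) algebra
      qed
      also have "\<dots> \<le> D / (q + \<nu>)"
      proof -
        have "D * (2 * \<kappa> * A * (q / (q + (\<nu> + B))) - \<nu> * (q / (q + \<nu>)) - C * A\<^sup>2 / q) \<ge> D * \<delta>"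
          using q1[OF q0(2)] D0 by (intro mult_left_mono) auto
        then have "0 \<le> D * (2 * \<kappa> * A * (q / (q + (\<nu> + B))) - \<nu> * (q / (q + \<nu>)) - C * A\<^sup>2 / q) - C * A\<^sup>2"
          using D0(2) by (simp only: mult.commute[of \<delta> D])
        then have "0 \<le> (D * (2 * \<kappa> * A * (q / (q + (\<nu> + B))) - \<nu> * (q / (q + \<nu>)) - C * A\<^sup>2 / q)
            - C * A\<^sup>2) / q\<^sup>2"
          by (rule divide_nonneg_nonneg) simp
        then show ?thesis by linarith
      qed
      finally show ?thesis .
    qed
    ultimately show "0 \<le> 1 - 2 * \<kappa> * \<alpha> + C * \<alpha>\<^sup>2 \<and>
       (1 - 2 * \<kappa> * \<alpha> + C * \<alpha>\<^sup>2) * (D / q) + C * \<alpha>\<^sup>2 \<le> D / (q + \<nu>)" by blast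
  qed (use \<delta> \<open>0 \<le> C\<close> in \<open>auto intro!: add_nonneg_pos\<close>)
qed

text \<open>Chung's lemma in the form needed for stochastic approximation.\<close>

lemma recursion_powr_rate:
  fixes a :: "nat \<Rightarrow> real" and A B C \<kappa> \<nu> :: real
  assumes rate: "0 < \<nu>" "\<nu> \<le> 1" "0 < \<kappa>" "A > \<nu> / (2 * \<kappa>)" "0 < B" "0 \<le> C"
    and \<alpha>: "\<And>l. l \<ge> 1 \<Longrightarrow> \<alpha> l = A / (real l powr \<nu> + B)"
    and rec: "\<And>l. l \<ge> 1 \<Longrightarrow>
      a (Suc l) \<le> (1 - 2 * \<kappa> * \<alpha> (Suc l) + C * (\<alpha> (Suc l))\<^sup>2) * a l + C * (\<alpha> (Suc l))\<^sup>2"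
  obtains D where "D > 0" "\<And>l. l \<ge> 1 \<Longrightarrow> a l \<le> D * real l powr (- \<nu>)"
proof -
  have A: "A > 0" using rate by (meson divide_pos_pos less_trans mult_pos_pos zero_less_numeral)
  obtain q0 D0 where q0: "0 < q0" "0 < D0" and cmp:
    "\<And>q \<alpha> D. \<lbrakk>q0 \<le> q; D0 \<le> D; A / (q + \<nu> + B) \<le> \<alpha>; \<alpha> \<le> A / q\<rbrakk> \<Longrightarrow>
       0 \<le> 1 - 2 * \<kappa> * \<alpha> + C * \<alpha>\<^sup>2 \<and>
       (1 - 2 * \<kappa> * \<alpha> + C * \<alpha>\<^sup>2) * (D / q) + C * \<alpha>\<^sup>2 \<le> D / (q + \<nu>)"
    using rate_comparison_eventually[OF rate(1,3,4,5,6)] by blast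
  define n where "n = nat \<lceil>q0 powr (1 / \<nu>)\<rceil> + 1"
  \<comment> \<open>Up to the index \<open>n\<close>, where \<open>q0 \<le> n\<^sup>\<nu>\<close>, the bound holds by the choice of \<open>D\<close>; beyond it by induction.\<close>
  define D where "D = D0 + (\<Sum>l\<le>n. \<bar>a l\<bar> * real l powr \<nu>)"
  have D: "D \<ge> D0" unfolding D_def by (simp add: sum_nonneg)
  have n: "real l powr \<nu> \<ge> q0" if "l \<ge> n" for l
  proof -
    have "q0 powr (1 / \<nu>) \<le> real l" using that unfolding n_def by linarith
    then have "(q0 powr (1 / \<nu>)) powr \<nu> \<le> real l powr \<nu>" using rate by (intro powr_mono2) auto
    then show ?thesis using rate q0 by (simp add: powr_powr)
  qed
  have small: "a l \<le> D * real l powr (- \<nu>)" if "l \<ge> 1" "l \<le> n" for l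
  proof -
    have "\<bar>a l\<bar> * real l powr \<nu> \<le> (\<Sum>l\<le>n. \<bar>a l\<bar> * real l powr \<nu>)"
      using that by (intro member_le_sum) auto
    then have "\<bar>a l\<bar> * real l powr \<nu> \<le> D" using q0 by (simp add: D_def)
    then have "\<bar>a l\<bar> \<le> D / real l powr \<nu>" using that by (simp add: field_simps)
    then show ?thesis by (simp add: powr_minus divide_inverse)
  qed
  have "a l \<le> D * real l powr (- \<nu>)" if "l \<ge> n" for l
    using that
  proof (induction l rule: dec_induct)
    case base
    then show ?case using small[of n] by (simp add: n_def)
  next
    case (step l)
    let ?q = "real l powr \<nu>" and ?\<alpha> = "\<alpha> (Suc l)"
    have l: "l \<ge> 1" using step by (simp add: n_def)
    have p: "real (Suc l) powr \<nu> \<le> ?q + \<nu>" "?q \<le> real (Suc l) powr \<nu>" "?q > 0"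
      using powr_Suc_le_add[OF rate(1,2) l] rate l by (auto intro: powr_mono2)
    have "0 \<le> 1 - 2 * \<kappa> * ?\<alpha> + C * ?\<alpha>\<^sup>2 \<and>
       (1 - 2 * \<kappa> * ?\<alpha> + C * ?\<alpha>\<^sup>2) * (D / ?q) + C * ?\<alpha>\<^sup>2 \<le> D / (?q + \<nu>)"
    proof (rule cmp)
      show "A / (?q + \<nu> + B) \<le> ?\<alpha>" "?\<alpha> \<le> A / ?q"
        unfolding \<alpha>[of "Suc l", simplified]
        using p A rate by (auto intro!: divide_left_mono mult_pos_pos add_pos_pos)
    qed (use n[OF step(1)] D in auto)
    then have "(1 - 2 * \<kappa> * ?\<alpha> + C * ?\<alpha>\<^sup>2) * a l + C * ?\<alpha>\<^sup>2 \<le> D / (?q + \<nu>)"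
      using mult_left_mono[OF step.IH, of "1 - 2 * \<kappa> * ?\<alpha> + C * ?\<alpha>\<^sup>2"]
      by (simp add: powr_minus divide_inverse)
    also have "\<dots> \<le> D / real (Suc l) powr \<nu>"
      using p D q0 rate by (intro divide_left_mono mult_pos_pos add_pos_pos) auto
    finally show ?case using rec[OF l] by (simp add: powr_minus divide_inverse)
  qed
  then show ?thesis using that[of D] small D q0 by (metis less_le_trans linorder_le_cases)
qed

section \<open>Sampling from a law that depends on the past\<close>

text \<open>If, given \<open>H\<close>, the variable \<open>Y\<close> has the law \<open>L (\<xi>)\<close> with \<open>\<xi>\<close> known from \<open>H\<close>, then \<open>F(\<xi>, Y)\<close> may be integrated by
first integrating over \<open>Y\<close> alone. The laws \<open>L\<close> are an arbitrary family, so the inner integral is known to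
be measurable only up to a null set, whence the function \<open>G\<close>. The conditional expectation proves this for
rectangles; the class of sets for which it holds is a Dynkin system because countably many null sets may be
discarded, and simple functions and monotone limits follow.\<close>

lemma (in prob_space) nn_integral_disintegration:
  assumes sub: "subalgebra M H" and xi: "\<xi> \<in> measurable H N" and Y: "Y \<in> measurable M P"
    and L: "\<And>\<zeta>. \<zeta> \<in> space N \<Longrightarrow> prob_space (L \<zeta>)" "\<And>\<zeta>. \<zeta> \<in> space N \<Longrightarrow> sets (L \<zeta>) = sets P"
    and cond: "\<And>B. B \<in> sets P \<Longrightarrow>
      AE \<omega> in M. real_cond_exp M H (indicator (Y -` B \<inter> space M)) \<omega> = measure (L (\<xi> \<omega>)) B"
    and F: "F \<in> borel_measurable (N \<Otimes>\<^sub>M P)"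
  shows "\<exists>G\<in>borel_measurable M. (AE \<omega> in M. G \<omega> = (\<integral>\<^sup>+y. F (\<xi> \<omega>, y) \<partial>L (\<xi> \<omega>)))
     \<and> (\<integral>\<^sup>+\<omega>. F (\<xi> \<omega>, Y \<omega>) \<partial>M) = (\<integral>\<^sup>+\<omega>. G \<omega> \<partial>M)"
proof -
  interpret S: finite_measure_subalgebra M H by standard (rule sub)
  have xiM [measurable]: "\<xi> \<in> measurable M N" by (rule measurable_from_subalg[OF sub xi])
  note Y [measurable]
  have spN: "\<xi> \<omega> \<in> space N" if "\<omega> \<in> space M" for \<omega> using xiM that by (rule measurable_space)
  have spH: "space H = space M" using sub by (simp add: subalgebra_def)
  \<comment> \<open>The property shown first for indicators of measurable sets, then for all nonnegative \<open>F\<close>.\<close>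
  define Q where "Q F \<longleftrightarrow> (\<exists>G\<in>borel_measurable M. (AE \<omega> in M. G \<omega> = (\<integral>\<^sup>+y. F (\<xi> \<omega>, y) \<partial>L (\<xi> \<omega>)))
     \<and> (\<integral>\<^sup>+\<omega>. F (\<xi> \<omega>, Y \<omega>) \<partial>M) = (\<integral>\<^sup>+\<omega>. G \<omega> \<partial>M))" for F :: "_ \<Rightarrow> ennreal"
  have slice: "(\<lambda>y. F (\<zeta>, y)) \<in> borel_measurable (L \<zeta>)"
    if "F \<in> borel_measurable (N \<Otimes>\<^sub>M P)" "\<zeta> \<in> space N" for F :: "_ \<Rightarrow> ennreal" and \<zeta>
  proof -
    have "(\<lambda>y. F (\<zeta>, y)) \<in> borel_measurable P" using that by measurable
    then show ?thesis using measurable_cong_sets[OF L(2)[OF that(2)] refl] by blast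
  qed
  have joint: "(\<lambda>\<omega>. F (\<xi> \<omega>, Y \<omega>)) \<in> borel_measurable M"
    if "F \<in> borel_measurable (N \<Otimes>\<^sub>M P)" for F :: "_ \<Rightarrow> ennreal"
    using that by measurable
  have Q_set: "Q (indicator C)" if "C \<in> sets (N \<Otimes>\<^sub>M P)" for C
    using that unfolding sets_pair_measure
  proof (induction rule: sigma_sets_induct_disjoint[OF Int_stable_pair_measure_generator
        pair_measure_closed, consumes 1, case_names basic empty compl union])
    case (basic C)
    then obtain A B where C: "C = A \<times> B" and A: "A \<in> sets N" and B: "B \<in> sets P" by blast
    define G where "G \<omega> = indicator A (\<xi> \<omega>) * ennreal (real_cond_exp M H (indicator (Y -` B \<inter> space M)) \<omega>)" for \<omega>
    have Gm: "G \<in> borel_measurable M" unfolding G_def using A by measurable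
    have AE: "AE \<omega> in M. G \<omega> = (\<integral>\<^sup>+y. indicator C (\<xi> \<omega>, y) \<partial>L (\<xi> \<omega>))"
      using cond[OF B] AE_space
    proof eventually_elim
      case (elim \<omega>)
      interpret L: prob_space "L (\<xi> \<omega>)" by (rule L(1)[OF spN[OF elim(2)]])
      have "B \<in> sets (L (\<xi> \<omega>))" using B L(2)[OF spN[OF elim(2)]] by simp
      then have "(\<integral>\<^sup>+y. indicator C (\<xi> \<omega>, y) \<partial>L (\<xi> \<omega>)) = indicator A (\<xi> \<omega>) * emeasure (L (\<xi> \<omega>)) B"
        by (simp add: C indicator_times nn_integral_cmult_indicator)
      then show ?case unfolding G_def elim(1) by (simp add: L.emeasure_eq_measure)
    qed
    \<comment> \<open>As \<open>A'\<close> belongs to \<open>H\<close>, the indicator of \<open>B'\<close> may be replaced by its conditional expectation on it.\<close>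
    define A' where "A' = \<xi> -` A \<inter> space M"
    have A': "A' \<in> sets H" using measurable_sets[OF xi A] by (simp add: A'_def spH)
    then have A'M: "A' \<in> sets M" using sub by (auto simp: subalgebra_def)
    define B' where "B' = Y -` B \<inter> space M"
    have B': "B' \<in> sets M" using measurable_sets[OF Y B] by (simp add: B'_def)
    have intB: "integrable M (indicator B' :: _ \<Rightarrow> real)"
      using B' by (simp add: integrable_indicator_iff emeasure_eq_measure)
    have pos: "AE \<omega> in M. 0 \<le> real_cond_exp M H (indicator B') \<omega>"
      by (rule S.real_cond_exp_pos) (use B' in auto)
    have "(\<integral>\<^sup>+\<omega>. indicator C (\<xi> \<omega>, Y \<omega>) \<partial>M) = (\<integral>\<^sup>+\<omega>. ennreal (indicator A' \<omega> * indicator B' \<omega>) \<partial>M)"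
      by (rule nn_integral_cong) (auto simp: C A'_def B'_def indicator_def)
    also have "\<dots> = ennreal (\<integral>\<omega>\<in>A'. indicator B' \<omega> \<partial>M)"
      unfolding set_lebesgue_integral_def using intB A'M B'
      by (subst nn_integral_eq_integral)
         (auto intro!: integrable_mult_indicator[where 'b=real, simplified])
    also have "(\<integral>\<omega>\<in>A'. indicator B' \<omega> \<partial>M) = (\<integral>\<omega>\<in>A'. real_cond_exp M H (indicator B') \<omega> \<partial>M)"
      by (rule S.real_cond_exp_intA[OF intB A'])
    also have "ennreal \<dots> = (\<integral>\<^sup>+\<omega>. ennreal (indicator A' \<omega> * real_cond_exp M H (indicator B') \<omega>) \<partial>M)"
      unfolding set_lebesgue_integral_def using pos integrable_mult_indicator[OF A'M S.real_cond_exp_int(1)[OF intB]]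
      by (subst nn_integral_eq_integral) auto
    also have "\<dots> = (\<integral>\<^sup>+\<omega>. G \<omega> \<partial>M)"
      by (rule nn_integral_cong) (auto simp: G_def A'_def B'_def indicator_def)
    finally show ?case unfolding Q_def using Gm AE by blast
  next
    case empty
    show ?case unfolding Q_def by (rule bexI[of _ "\<lambda>_. 0"]) auto
  next
    case (compl C)
    then have C: "C \<in> sets (N \<Otimes>\<^sub>M P)" by (simp add: sets_pair_measure)
    from compl obtain G where G [measurable]: "G \<in> borel_measurable M"
      and GA: "AE \<omega> in M. G \<omega> = (\<integral>\<^sup>+y. indicator C (\<xi> \<omega>, y) \<partial>L (\<xi> \<omega>))"
      and GI: "(\<integral>\<^sup>+\<omega>. indicator C (\<xi> \<omega>, Y \<omega>) \<partial>M) = (\<integral>\<^sup>+\<omega>. G \<omega> \<partial>M)" unfolding Q_def by blast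
    have ind: "indicator (space N \<times> space P - C) (z, y) = (1::ennreal) - indicator C (z, y)"
      if "z \<in> space N" "y \<in> space P" for z y using that by (auto simp: indicator_def)
    have AE: "AE \<omega> in M. 1 - G \<omega> = (\<integral>\<^sup>+y. indicator (space N \<times> space P - C) (\<xi> \<omega>, y) \<partial>L (\<xi> \<omega>))"
      using GA AE_space
    proof eventually_elim
      case (elim \<omega>)
      note z = spN[OF elim(2)]
      interpret L: prob_space "L (\<xi> \<omega>)" by (rule L(1)[OF z])
      have sp: "space (L (\<xi> \<omega>)) = space P" using L(2)[OF z] by (rule sets_eq_imp_space_eq)
      have "(\<integral>\<^sup>+y. indicator (space N \<times> space P - C) (\<xi> \<omega>, y) \<partial>L (\<xi> \<omega>))
          = (\<integral>\<^sup>+y. 1 - indicator C (\<xi> \<omega>, y) \<partial>L (\<xi> \<omega>))"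
        by (rule nn_integral_cong) (simp add: sp ind[OF z])
      also have "\<dots> = (\<integral>\<^sup>+y. 1 \<partial>L (\<xi> \<omega>)) - (\<integral>\<^sup>+y. indicator C (\<xi> \<omega>, y) \<partial>L (\<xi> \<omega>))"
      proof (rule nn_integral_diff)
        have "(\<integral>\<^sup>+y. indicator C (\<xi> \<omega>, y) \<partial>L (\<xi> \<omega>)) \<le> (\<integral>\<^sup>+y. 1 \<partial>L (\<xi> \<omega>))"
          by (rule nn_integral_mono) (simp add: indicator_def)
        then show "(\<integral>\<^sup>+y. indicator C (\<xi> \<omega>, y) \<partial>L (\<xi> \<omega>)) \<noteq> \<infinity>"
          by (auto simp: L.emeasure_space_1 top_unique)
        show "(\<lambda>y. indicator C (\<xi> \<omega>, y) :: ennreal) \<in> borel_measurable (L (\<xi> \<omega>))"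
          by (rule slice[OF _ z]) (use C in simp)
      qed (auto simp: indicator_def)
      finally show ?case using elim(1) by (simp add: L.emeasure_space_1)
    qed
    \<comment> \<open>Subtraction is legitimate because all integrals of indicators are at most \<open>1\<close>.\<close>
    have "(\<integral>\<^sup>+\<omega>. indicator (space N \<times> space P - C) (\<xi> \<omega>, Y \<omega>) \<partial>M)
        = (\<integral>\<^sup>+\<omega>. 1 - indicator C (\<xi> \<omega>, Y \<omega>) \<partial>M)"
      by (rule nn_integral_cong) (simp add: ind[OF spN measurable_space[OF Y]])
    also have "\<dots> = (\<integral>\<^sup>+\<omega>. 1 \<partial>M) - (\<integral>\<^sup>+\<omega>. indicator C (\<xi> \<omega>, Y \<omega>) \<partial>M)"
    proof (rule nn_integral_diff)
      have "(\<integral>\<^sup>+\<omega>. indicator C (\<xi> \<omega>, Y \<omega>) \<partial>M) \<le> (\<integral>\<^sup>+\<omega>. 1 \<partial>M)"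
        by (rule nn_integral_mono) (simp add: indicator_def)
      then show "(\<integral>\<^sup>+\<omega>. indicator C (\<xi> \<omega>, Y \<omega>) \<partial>M) \<noteq> \<infinity>"
        by (auto simp: emeasure_space_1 top_unique)
      show "(\<lambda>\<omega>. indicator C (\<xi> \<omega>, Y \<omega>) :: ennreal) \<in> borel_measurable M"
        by (rule joint) (use C in simp)
    qed (auto simp: indicator_def)
    also have "\<dots> = (\<integral>\<^sup>+\<omega>. 1 \<partial>M) - (\<integral>\<^sup>+\<omega>. G \<omega> \<partial>M)" by (simp add: GI)
    also have "\<dots> = (\<integral>\<^sup>+\<omega>. 1 - G \<omega> \<partial>M)"
    proof (rule nn_integral_diff[symmetric])
      show "AE \<omega> in M. G \<omega> \<le> 1"
        using GA AE_space
      proof eventually_elim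
        case (elim \<omega>)
        interpret L: prob_space "L (\<xi> \<omega>)" by (rule L(1)[OF spN[OF elim(2)]])
        have "(\<integral>\<^sup>+y. indicator C (\<xi> \<omega>, y) \<partial>L (\<xi> \<omega>)) \<le> (\<integral>\<^sup>+y. 1 \<partial>L (\<xi> \<omega>))"
          by (rule nn_integral_mono) (simp add: indicator_def)
        then show ?case by (simp add: elim(1) L.emeasure_space_1)
      qed
      then have "(\<integral>\<^sup>+\<omega>. G \<omega> \<partial>M) \<le> (\<integral>\<^sup>+\<omega>. 1 \<partial>M)" by (rule nn_integral_mono_AE)
      then show "(\<integral>\<^sup>+\<omega>. G \<omega> \<partial>M) \<noteq> \<infinity>" by (auto simp: emeasure_space_1 top_unique)
    qed auto
    finally show ?case unfolding Q_def using AE by (intro bexI[of _ "\<lambda>\<omega>. 1 - G \<omega>"]) auto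
  next
    case (union C)
    then have C: "C i \<in> sets (N \<Otimes>\<^sub>M P)" for i by (auto simp: sets_pair_measure)
    have "\<exists>G. \<forall>i. G i \<in> borel_measurable M \<and>
        (AE \<omega> in M. G i \<omega> = (\<integral>\<^sup>+y. indicator (C i) (\<xi> \<omega>, y) \<partial>L (\<xi> \<omega>))) \<and>
        (\<integral>\<^sup>+\<omega>. indicator (C i) (\<xi> \<omega>, Y \<omega>) \<partial>M) = (\<integral>\<^sup>+\<omega>. G i \<omega> \<partial>M)"
      using union(3) unfolding Q_def by (intro choice) blast
    then obtain G where G [measurable]: "\<And>i. G i \<in> borel_measurable M"
      and GA: "\<And>i. AE \<omega> in M. G i \<omega> = (\<integral>\<^sup>+y. indicator (C i) (\<xi> \<omega>, y) \<partial>L (\<xi> \<omega>))"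
      and GI: "\<And>i. (\<integral>\<^sup>+\<omega>. indicator (C i) (\<xi> \<omega>, Y \<omega>) \<partial>M) = (\<integral>\<^sup>+\<omega>. G i \<omega> \<partial>M)"
      by blast
    have ind: "indicator (\<Union>i. C i) x = (\<Sum>i. indicator (C i) x :: ennreal)" for x
      using suminf_indicator[OF union(1), of x] by simp
    have "AE \<omega> in M. (\<Sum>i. G i \<omega>) = (\<integral>\<^sup>+y. indicator (\<Union>i. C i) (\<xi> \<omega>, y) \<partial>L (\<xi> \<omega>))"
    proof -
      have "AE \<omega> in M. \<forall>i. G i \<omega> = (\<integral>\<^sup>+y. indicator (C i) (\<xi> \<omega>, y) \<partial>L (\<xi> \<omega>))"
        using GA by (simp add: AE_all_countable)
      then show ?thesis using AE_space
      proof eventually_elim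
        case (elim \<omega>)
        then show ?case unfolding ind
          by (subst nn_integral_suminf) (auto intro!: slice[OF _ spN[OF elim(2)]] C borel_measurable_indicator)
      qed
    qed
    moreover have "(\<integral>\<^sup>+\<omega>. indicator (\<Union>i. C i) (\<xi> \<omega>, Y \<omega>) \<partial>M) = (\<integral>\<^sup>+\<omega>. (\<Sum>i. G i \<omega>) \<partial>M)"
      unfolding ind by (subst nn_integral_suminf) (auto intro!: joint C borel_measurable_indicator simp: GI nn_integral_suminf)
    ultimately show ?case unfolding Q_def by (intro bexI[of _ "\<lambda>\<omega>. \<Sum>i. G i \<omega>"]) auto
  qed
  have "Q F" using F
  proof (induction rule: borel_measurable_induct)
    case (cong F' F)
    have eq: "F' (\<xi> \<omega>, y) = F (\<xi> \<omega>, y)" if "\<omega> \<in> space M" "y \<in> space P" for \<omega> y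
      using cong(3) that spN by (auto simp: space_pair_measure)
    have sp: "space (L (\<xi> \<omega>)) = space P" if "\<omega> \<in> space M" for \<omega>
      using L(2)[OF spN[OF that]] by (rule sets_eq_imp_space_eq)
    obtain G where G: "G \<in> borel_measurable M"
      and GA: "AE \<omega> in M. G \<omega> = (\<integral>\<^sup>+y. F (\<xi> \<omega>, y) \<partial>L (\<xi> \<omega>))"
      and GI: "(\<integral>\<^sup>+\<omega>. F (\<xi> \<omega>, Y \<omega>) \<partial>M) = (\<integral>\<^sup>+\<omega>. G \<omega> \<partial>M)" using cong(4) unfolding Q_def by blast
    have "AE \<omega> in M. G \<omega> = (\<integral>\<^sup>+y. F' (\<xi> \<omega>, y) \<partial>L (\<xi> \<omega>))"
      using GA AE_space
    proof eventually_elim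
      case (elim \<omega>)
      then show ?case using eq sp by (auto intro!: nn_integral_cong)
    qed
    moreover have "(\<integral>\<^sup>+\<omega>. F (\<xi> \<omega>, Y \<omega>) \<partial>M) = (\<integral>\<^sup>+\<omega>. F' (\<xi> \<omega>, Y \<omega>) \<partial>M)"
      using eq measurable_space[OF Y] by (intro nn_integral_cong) auto
    ultimately show ?case using G GI unfolding Q_def by auto
  next
    case (set C)
    then show ?case by (intro Q_set)
  next
    case (mult F c)
    then obtain G where [measurable]: "G \<in> borel_measurable M"
      and GA: "AE \<omega> in M. G \<omega> = (\<integral>\<^sup>+y. F (\<xi> \<omega>, y) \<partial>L (\<xi> \<omega>))"
      and GI: "(\<integral>\<^sup>+\<omega>. F (\<xi> \<omega>, Y \<omega>) \<partial>M) = (\<integral>\<^sup>+\<omega>. G \<omega> \<partial>M)" unfolding Q_def by blast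
    have "AE \<omega> in M. c * G \<omega> = (\<integral>\<^sup>+y. c * F (\<xi> \<omega>, y) \<partial>L (\<xi> \<omega>))"
      using GA AE_space by eventually_elim (simp add: nn_integral_cmult slice[OF mult(2)] spN)
    then show ?case unfolding Q_def
      by (intro bexI[of _ "\<lambda>\<omega>. c * G \<omega>"]) (auto simp: nn_integral_cmult joint[OF mult(2)] GI)
  next
    case (add F F')
    then obtain G G' where [measurable]: "G \<in> borel_measurable M" "G' \<in> borel_measurable M"
      and GA: "AE \<omega> in M. G \<omega> = (\<integral>\<^sup>+y. F (\<xi> \<omega>, y) \<partial>L (\<xi> \<omega>))"
        "AE \<omega> in M. G' \<omega> = (\<integral>\<^sup>+y. F' (\<xi> \<omega>, y) \<partial>L (\<xi> \<omega>))"
      and GI: "(\<integral>\<^sup>+\<omega>. F (\<xi> \<omega>, Y \<omega>) \<partial>M) = (\<integral>\<^sup>+\<omega>. G \<omega> \<partial>M)"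
        "(\<integral>\<^sup>+\<omega>. F' (\<xi> \<omega>, Y \<omega>) \<partial>M) = (\<integral>\<^sup>+\<omega>. G' \<omega> \<partial>M)" unfolding Q_def by blast
    have m: "F \<in> borel_measurable (N \<Otimes>\<^sub>M P)" "F' \<in> borel_measurable (N \<Otimes>\<^sub>M P)" using add by auto
    have "AE \<omega> in M. G' \<omega> + G \<omega> = (\<integral>\<^sup>+y. F' (\<xi> \<omega>, y) + F (\<xi> \<omega>, y) \<partial>L (\<xi> \<omega>))"
      using GA AE_space by eventually_elim (simp add: nn_integral_add slice[OF m(1)] slice[OF m(2)] spN)
    then show ?case unfolding Q_def
      by (intro bexI[of _ "\<lambda>\<omega>. G' \<omega> + G \<omega>"])
         (auto simp: nn_integral_add joint[OF m(1)] joint[OF m(2)] GI)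
  next
    case (seq U)
    have "\<exists>G. \<forall>i. G i \<in> borel_measurable M \<and>
        (AE \<omega> in M. G i \<omega> = (\<integral>\<^sup>+y. U i (\<xi> \<omega>, y) \<partial>L (\<xi> \<omega>))) \<and>
        (\<integral>\<^sup>+\<omega>. U i (\<xi> \<omega>, Y \<omega>) \<partial>M) = (\<integral>\<^sup>+\<omega>. G i \<omega> \<partial>M)"
      using seq.IH unfolding Q_def by (intro choice) blast
    then obtain G where G [measurable]: "\<And>i. G i \<in> borel_measurable M"
      and GA: "\<And>i. AE \<omega> in M. G i \<omega> = (\<integral>\<^sup>+y. U i (\<xi> \<omega>, y) \<partial>L (\<xi> \<omega>))"
      and GI: "\<And>i. (\<integral>\<^sup>+\<omega>. U i (\<xi> \<omega>, Y \<omega>) \<partial>M) = (\<integral>\<^sup>+\<omega>. G i \<omega> \<partial>M)"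
      by blast
    have AEi: "AE \<omega> in M. \<forall>i. G i \<omega> = (\<integral>\<^sup>+y. U i (\<xi> \<omega>, y) \<partial>L (\<xi> \<omega>))"
      using GA by (simp add: AE_all_countable)
    have Finc: "U i x \<le> U (Suc i) x" for i x using \<open>incseq U\<close> by (metis incseq_SucD le_funD)
    have "AE \<omega> in M. (SUP i. G i \<omega>) = (\<integral>\<^sup>+y. (SUP i. U i) (\<xi> \<omega>, y) \<partial>L (\<xi> \<omega>))"
      using AEi AE_space
    proof eventually_elim
      case (elim \<omega>)
      show ?case unfolding SUP_apply
        by (subst nn_integral_monotone_convergence_SUP)
           (use elim Finc slice[OF seq(1) spN[OF elim(2)]] in \<open>auto simp: incseq_Suc_iff le_fun_def\<close>)
    qed
    moreover have "(\<integral>\<^sup>+\<omega>. (SUP i. U i) (\<xi> \<omega>, Y \<omega>) \<partial>M) = (\<integral>\<^sup>+\<omega>. (SUP i. G i \<omega>) \<partial>M)"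
    proof -
      have "(\<integral>\<^sup>+\<omega>. (SUP i. U i) (\<xi> \<omega>, Y \<omega>) \<partial>M) = (SUP i. \<integral>\<^sup>+\<omega>. U i (\<xi> \<omega>, Y \<omega>) \<partial>M)"
        unfolding SUP_apply
        by (rule nn_integral_monotone_convergence_SUP)
           (use Finc joint[OF seq(1)] in \<open>auto simp: incseq_Suc_iff le_fun_def\<close>)
      also have "\<dots> = (SUP i. \<integral>\<^sup>+\<omega>. G i \<omega> \<partial>M)" by (simp add: GI)
      also have "\<dots> = (\<integral>\<^sup>+\<omega>. (SUP i. G i \<omega>) \<partial>M)"
      proof (rule nn_integral_monotone_convergence_SUP_AE[symmetric])
        show "AE \<omega> in M. G i \<omega> \<le> G (Suc i) \<omega>" for i
          using AEi by eventually_elim (auto intro!: nn_integral_mono Finc)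
      qed auto
      finally show ?thesis .
    qed
    ultimately show ?case unfolding Q_def by (intro bexI[of _ "\<lambda>\<omega>. SUP i. G i \<omega>"]) auto
  qed
  then show ?thesis by (simp add: Q_def)
qed

text \<open>The conditional mean of a signed function. The positive and the negative part are disintegrated separately;
the inequality between means is rewritten without subtraction, so that it can be integrated in the
extended nonnegative reals.\<close>

lemma (in prob_space) expectation_conditional_le:
  fixes u :: "'z \<times> 'y \<Rightarrow> real" and k :: "'z \<Rightarrow> real"
  assumes sub: "subalgebra M H" and xi: "\<xi> \<in> measurable H N" and Y: "Y \<in> measurable M P"
    and L: "\<And>\<zeta>. \<zeta> \<in> space N \<Longrightarrow> prob_space (L \<zeta>)" "\<And>\<zeta>. \<zeta> \<in> space N \<Longrightarrow> sets (L \<zeta>) = sets P"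
    and cond: "\<And>B. B \<in> sets P \<Longrightarrow>
      AE \<omega> in M. real_cond_exp M H (indicator (Y -` B \<inter> space M)) \<omega> = measure (L (\<xi> \<omega>)) B"
    and u: "u \<in> borel_measurable (N \<Otimes>\<^sub>M P)"
    and uL: "\<And>\<zeta>. \<zeta> \<in> space N \<Longrightarrow> integrable (L \<zeta>) (\<lambda>y. u (\<zeta>, y))"
    and le: "\<And>\<zeta>. \<zeta> \<in> space N \<Longrightarrow> (\<integral>y. u (\<zeta>, y) \<partial>L \<zeta>) \<le> - k \<zeta>"
    and k0: "\<And>\<zeta>. \<zeta> \<in> space N \<Longrightarrow> 0 \<le> k \<zeta>"
    and ki: "integrable M (\<lambda>\<omega>. k (\<xi> \<omega>))"
    and ui: "integrable M (\<lambda>\<omega>. u (\<xi> \<omega>, Y \<omega>))"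
  shows "(\<integral>\<omega>. u (\<xi> \<omega>, Y \<omega>) \<partial>M) \<le> - (\<integral>\<omega>. k (\<xi> \<omega>) \<partial>M)"
proof -
  have xiM: "\<xi> \<in> measurable M N" by (rule measurable_from_subalg[OF sub xi])
  have spN: "\<xi> \<omega> \<in> space N" if "\<omega> \<in> space M" for \<omega> using xiM that by (rule measurable_space)
  have um: "(\<lambda>x. ennreal (u x)) \<in> borel_measurable (N \<Otimes>\<^sub>M P)" "(\<lambda>x. ennreal (- u x)) \<in> borel_measurable (N \<Otimes>\<^sub>M P)"
    using u by auto
  note dis = nn_integral_disintegration[OF sub xi Y L cond]
  obtain G where G [measurable]: "G \<in> borel_measurable M"
    and GA: "AE \<omega> in M. G \<omega> = (\<integral>\<^sup>+y. ennreal (u (\<xi> \<omega>, y)) \<partial>L (\<xi> \<omega>))"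
    and GI: "(\<integral>\<^sup>+\<omega>. ennreal (u (\<xi> \<omega>, Y \<omega>)) \<partial>M) = (\<integral>\<^sup>+\<omega>. G \<omega> \<partial>M)"
    using dis[OF _ _ _ um(1)] by blast
  obtain G' where G' [measurable]: "G' \<in> borel_measurable M"
    and GA': "AE \<omega> in M. G' \<omega> = (\<integral>\<^sup>+y. ennreal (- u (\<xi> \<omega>, y)) \<partial>L (\<xi> \<omega>))"
    and GI': "(\<integral>\<^sup>+\<omega>. ennreal (- u (\<xi> \<omega>, Y \<omega>)) \<partial>M) = (\<integral>\<^sup>+\<omega>. G' \<omega> \<partial>M)"
    using dis[OF _ _ _ um(2)] by blast
  have "AE \<omega> in M. G \<omega> + ennreal (k (\<xi> \<omega>)) \<le> G' \<omega>"
    using GA GA' AE_space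
  proof eventually_elim
    case (elim \<omega>)
    note z = spN[OF elim(3)]
    have fin: "(\<integral>\<^sup>+y. ennreal (u (\<xi> \<omega>, y)) \<partial>L (\<xi> \<omega>)) < \<infinity>" "(\<integral>\<^sup>+y. ennreal (- u (\<xi> \<omega>, y)) \<partial>L (\<xi> \<omega>)) < \<infinity>"
      using uL[OF z] by (auto simp: real_integrable_def top.not_eq_extremum)
    have "enn2real (\<integral>\<^sup>+y. ennreal (u (\<xi> \<omega>, y)) \<partial>L (\<xi> \<omega>)) + k (\<xi> \<omega>)
        \<le> enn2real (\<integral>\<^sup>+y. ennreal (- u (\<xi> \<omega>, y)) \<partial>L (\<xi> \<omega>))"
      using le[OF z] real_lebesgue_integral_def[OF uL[OF z]] by simp
    then have "ennreal (enn2real (\<integral>\<^sup>+y. ennreal (u (\<xi> \<omega>, y)) \<partial>L (\<xi> \<omega>)) + k (\<xi> \<omega>))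
        \<le> ennreal (enn2real (\<integral>\<^sup>+y. ennreal (- u (\<xi> \<omega>, y)) \<partial>L (\<xi> \<omega>)))" by (rule ennreal_leI)
    then show ?case using fin k0[OF z] by (simp add: elim(1,2) ennreal_plus)
  qed
  then have "(\<integral>\<^sup>+\<omega>. G \<omega> + ennreal (k (\<xi> \<omega>)) \<partial>M) \<le> (\<integral>\<^sup>+\<omega>. G' \<omega> \<partial>M)" by (rule nn_integral_mono_AE)
  then have "(\<integral>\<^sup>+\<omega>. G \<omega> \<partial>M) + (\<integral>\<^sup>+\<omega>. ennreal (k (\<xi> \<omega>)) \<partial>M) \<le> (\<integral>\<^sup>+\<omega>. G' \<omega> \<partial>M)"
    using ki by (subst (asm) nn_integral_add) auto
  moreover have "(\<integral>\<^sup>+\<omega>. ennreal (k (\<xi> \<omega>)) \<partial>M) = ennreal (\<integral>\<omega>. k (\<xi> \<omega>) \<partial>M)"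
    using ki k0 spN by (intro nn_integral_eq_integral) (auto intro!: AE_I2)
  moreover have fin: "(\<integral>\<^sup>+\<omega>. G \<omega> \<partial>M) < \<infinity>" "(\<integral>\<^sup>+\<omega>. G' \<omega> \<partial>M) < \<infinity>"
    using ui by (auto simp: real_integrable_def top.not_eq_extremum GI GI')
  moreover have "0 \<le> (\<integral>\<omega>. k (\<xi> \<omega>) \<partial>M)"
    using k0 spN by (intro integral_nonneg_AE) (auto intro!: AE_I2)
  ultimately have "enn2real (\<integral>\<^sup>+\<omega>. G \<omega> \<partial>M) + (\<integral>\<omega>. k (\<xi> \<omega>) \<partial>M) \<le> enn2real (\<integral>\<^sup>+\<omega>. G' \<omega> \<partial>M)"
    by (metis enn2real_mono enn2real_plus enn2real_ennreal ennreal_less_top infinity_ennreal_def)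
  then show ?thesis using real_lebesgue_integral_def[OF ui] by (simp add: GI GI')
qed

section \<open>Joint measurability of the increment\<close>

text \<open>A Caratheodory function is jointly measurable: approximate the identity of the parameter space by simple
functions. Inserting such a function splits \<open>u\<close> into finitely many measurable pieces, and continuity in the
parameter passes to the limit.\<close>

lemma borel_measurable_Caratheodory:
  fixes u :: "'z::{metric_space, second_countable_topology} \<Rightarrow> 'x \<Rightarrow> real"
  assumes meas: "\<And>\<zeta>. u \<zeta> \<in> borel_measurable N"
    and cont: "\<And>x. x \<in> space N \<Longrightarrow> continuous_on UNIV (\<lambda>\<zeta>. u \<zeta> x)"
  shows "(\<lambda>(\<zeta>, x). u \<zeta> x) \<in> borel_measurable (borel \<Otimes>\<^sub>M N)"
proof -
  obtain s :: "nat \<Rightarrow> 'z \<Rightarrow> 'z" where s: "\<And>n. simple_function borel (s n)"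
    and lim: "\<And>\<zeta>. (\<lambda>n. s n \<zeta>) \<longlonglongrightarrow> \<zeta>"
    using borel_measurable_implies_sequence_metric[of "\<lambda>x. x" borel undefined] by auto
  have "(\<lambda>p. u (s n (fst p)) (snd p)) \<in> borel_measurable (borel \<Otimes>\<^sub>M N)" for n
  proof (rule measurable_compose_countable'[where f="\<lambda>\<zeta> p. u \<zeta> (snd p)" and g="\<lambda>p. s n (fst p)"])
    show "(\<lambda>p. u \<zeta> (snd p)) \<in> borel_measurable (borel \<Otimes>\<^sub>M N)" for \<zeta> using meas by measurable
    have fin: "finite (range (s n))" using simple_functionD(1)[OF s[of n]] by simp
    have "s n \<in> measurable borel (count_space UNIV)" using s by (rule measurable_simple_function)
    then have "s n \<in> measurable borel (count_space (range (s n)))"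
      by (auto simp: measurable_count_space_eq2[OF fin] intro!: simple_functionD(2)[OF s, simplified])
    then show "(\<lambda>p. s n (fst p)) \<in> borel \<Otimes>\<^sub>M N \<rightarrow>\<^sub>M count_space (range (s n))" by measurable
    show "countable (range (s n))" using fin by (rule countable_finite)
  qed
  then show ?thesis
    unfolding case_prod_beta'
  proof (rule borel_measurable_LIMSEQ_metric)
    fix p assume "p \<in> space (borel \<Otimes>\<^sub>M N :: ('z \<times> 'x) measure)"
    then have "snd p \<in> space N" by (auto simp: space_pair_measure)
    then have "isCont (\<lambda>\<zeta>. u \<zeta> (snd p)) (fst p)" using cont by (auto simp: continuous_on_eq_continuous_at)
    then show "(\<lambda>n. u (s n (fst p)) (snd p)) \<longlonglongrightarrow> u (fst p) (snd p)"
      using lim isCont_tendsto_compose by fast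
  qed
qed

lemma GDERIV_unique:
  assumes "GDERIV f x :> D" "GDERIV f x :> D'" shows "D = D'"
proof -
  have "(\<lambda>h. h \<bullet> D) = (\<lambda>h. h \<bullet> D')"
    using assms unfolding gderiv_def by (rule has_derivative_unique)
  then show ?thesis by (metis inner_commute vector_eq_rdot)
qed

text \<open>The Riesz representation of the derivative is obtained as the value at \<open>1\<close> of its adjoint.\<close>

lemma param_gradient_GDERIV:
  fixes V :: "real ^ 'l \<Rightarrow> real \<Rightarrow> real ^ 'n \<Rightarrow> 'm \<Rightarrow> real"
  assumes "(\<lambda>\<theta>. V \<theta> t x i) differentiable (at \<zeta>)"
  shows "GDERIV (\<lambda>\<theta>. V \<theta> t x i) \<zeta> :> param_gradient V \<zeta> t x i"
proof -
  obtain f' where f': "((\<lambda>\<theta>. V \<theta> t x i) has_derivative f') (at \<zeta>)"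
    using assms by (auto simp: differentiable_def)
  then interpret bounded_linear f' by (rule has_derivative_bounded_linear)
  have "f' h = h \<bullet> adjoint f' 1" for h
    using adjoint_works[OF linear_axioms, of h 1] by simp
  then have D: "GDERIV (\<lambda>\<theta>. V \<theta> t x i) \<zeta> :> adjoint f' 1"
    using f' unfolding gderiv_def by (metis (no_types, lifting) ext)
  then show ?thesis unfolding param_gradient_def by (rule theI) (rule GDERIV_unique[OF _ D])
qed

text \<open>Displays every component of the gradient as a limit of a sequence of functions built from \<open>f\<close> itself, so that
measurability is inherited.\<close>

lemma GDERIV_difference_quotient:
  assumes "GDERIV f \<zeta> :> D"
  shows "(\<lambda>n. real (Suc n) * (f (\<zeta> + (1 / real (Suc n)) *\<^sub>R b) - f \<zeta>)) \<longlonglongrightarrow> D \<bullet> b"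
proof -
  have "((\<lambda>s. f (\<zeta> + s *\<^sub>R b)) has_derivative (\<lambda>s. (s *\<^sub>R b) \<bullet> D)) (at 0)"
    using assms unfolding gderiv_def
    by (intro has_derivative_compose[of "\<lambda>s. \<zeta> + s *\<^sub>R b" "\<lambda>s. s *\<^sub>R b" 0 UNIV f "\<lambda>h. h \<bullet> D"])
       (auto intro!: derivative_eq_intros)
  moreover have eq: "(\<lambda>s. (s *\<^sub>R b) \<bullet> D) = (*) (D \<bullet> b)"
    by (rule ext) (simp only: inner_scaleR_left inner_commute[of b D] mult.commute)
  ultimately have "((\<lambda>s. f (\<zeta> + s *\<^sub>R b)) has_field_derivative D \<bullet> b) (at 0)"
    by (simp only: has_field_derivative_def eq)
  then have "((\<lambda>s. (f (\<zeta> + s *\<^sub>R b) - f \<zeta>) / s) \<longlongrightarrow> D \<bullet> b) (at 0)"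
    by (simp add: has_field_derivative_iff)
  moreover have "filterlim (\<lambda>n. 1 / real (Suc n)) (at 0) sequentially"
    unfolding filterlim_at using LIMSEQ_Suc[OF lim_1_over_n] by (auto simp del: of_nat_Suc)
  ultimately have "(\<lambda>n. (f (\<zeta> + (1 / real (Suc n)) *\<^sub>R b) - f \<zeta>) / (1 / real (Suc n))) \<longlonglongrightarrow> D \<bullet> b"
    by (rule filterlim_compose)
  then show ?thesis by (simp add: mult.commute del: of_nat_Suc)
qed

lemma borel_measurable_at_time:
  fixes u :: "real \<Rightarrow> (real ^ 'n) \<Rightarrow> real"
  assumes "(\<lambda>(t, x). u t x) \<in> borel_measurable (restrict_space borel ({0..T} \<times> UNIV))" "t \<in> {0..T}"
  shows "u t \<in> borel_measurable borel"
proof -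
  have "(\<lambda>x. (t, x)) \<in> measurable borel (restrict_space borel ({0..T} \<times> UNIV))"
    using assms(2) by (intro measurable_restrict_space2) (auto intro!: borel_measurable_continuous_onI continuous_intros)
  from measurable_compose[OF this assms(1)] show ?thesis by simp
qed

lemma grid_time_mem: "K > 0 \<Longrightarrow> T > 0 \<Longrightarrow> k \<le> K \<Longrightarrow> grid_time T K k \<in> {0..T}"
  by (simp add: grid_time_def field_simps mult_mono)

text \<open>The increment consists of finitely many evaluations of the path at grid times in \<open>[0, T]\<close>. For a fixed regime every
ingredient is jointly measurable in the parameter and the state; as there are finitely many regimes, the
regime at the grid time may be inserted afterwards.\<close>

lemma borel_measurable_Psi:
  fixes V :: "real ^ 'l \<Rightarrow> real \<Rightarrow> real ^ 'n \<Rightarrow> 'm::finite \<Rightarrow> real"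
  assumes "T > 0" "K > 0"
    and f: "\<And>i. (\<lambda>(t, x). f t x i) \<in> borel_measurable (restrict_space borel ({0..T} \<times> UNIV))"
    and V: "\<And>\<zeta> i. (\<lambda>(t, x). V \<zeta> t x i) \<in> borel_measurable (restrict_space borel ({0..T} \<times> UNIV))"
    and diff: "\<And>\<zeta> t x i. t \<in> {0..T} \<Longrightarrow> (\<lambda>\<theta>. V \<theta> t x i) differentiable (at \<zeta>)"
  shows "(\<lambda>(\<zeta>, y). Psi T K f g lam V \<zeta> y) \<in> borel_measurable (borel \<Otimes>\<^sub>M path_space T)"
proof -
  let ?P = "borel \<Otimes>\<^sub>M path_space T :: ((real ^ 'l) \<times> ('n, 'm) path) measure"
  have ft: "(\<lambda>x. f t x i) \<in> borel_measurable borel" if "t \<in> {0..T}" for t i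
    using borel_measurable_at_time[OF f that] .
  have Vt: "(\<lambda>p. V (fst p) t (snd p) i) \<in> borel_measurable (borel \<Otimes>\<^sub>M borel)" if "t \<in> {0..T}" for t i
  proof -
    have "(\<lambda>(\<zeta>, x). V \<zeta> t x i) \<in> borel_measurable (borel \<Otimes>\<^sub>M borel)"
      using borel_measurable_at_time[OF V that] diff[OF that]
      by (intro borel_measurable_Caratheodory)
         (auto simp: continuous_on_eq_continuous_at intro: differentiable_imp_continuous_within)
    then show ?thesis by (simp add: case_prod_beta')
  qed
  have Gt: "(\<lambda>p. param_gradient V (fst p) t (snd p) i) \<in> borel_measurable (borel \<Otimes>\<^sub>M borel)"
    if t: "t \<in> {0..T}" for t i
  proof (subst borel_measurable_euclidean_space, rule ballI)
    fix b :: "real ^ 'l" assume "b \<in> Basis"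
    show "(\<lambda>p. param_gradient V (fst p) t (snd p) i \<bullet> b) \<in> borel_measurable (borel \<Otimes>\<^sub>M borel)"
    proof (rule borel_measurable_LIMSEQ_metric)
      show "(\<lambda>n. real (Suc n) * (V (fst p + (1 / real (Suc n)) *\<^sub>R b) t (snd p) i - V (fst p) t (snd p) i))
          \<longlonglongrightarrow> param_gradient V (fst p) t (snd p) i \<bullet> b" for p
        by (rule GDERIV_difference_quotient[where f="\<lambda>\<theta>. V \<theta> t (snd p) i"],
            rule param_gradient_GDERIV, rule diff[OF t])
      have shifted [measurable]: "(\<lambda>p. V (fst p + c *\<^sub>R b) t (snd p) i) \<in> borel_measurable (borel \<Otimes>\<^sub>M borel)" for c
      proof -
        have "(\<lambda>p. (fst p + c *\<^sub>R b, snd p)) \<in> measurable (borel \<Otimes>\<^sub>M borel) (borel \<Otimes>\<^sub>M (borel :: (real ^ 'n) measure))"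
          by measurable
        from measurable_compose[OF this Vt[OF t]] show ?thesis by (simp only: fst_conv snd_conv)
      qed
      show "(\<lambda>p. real (Suc n) * (V (fst p + (1 / real (Suc n)) *\<^sub>R b) t (snd p) i - V (fst p) t (snd p) i))
          \<in> borel_measurable (borel \<Otimes>\<^sub>M borel)" for n
        by (intro borel_measurable_times borel_measurable_diff borel_measurable_const shifted Vt[OF t])
    qed
  qed
  have ev: "(\<lambda>p. snd p t) \<in> measurable ?P (borel \<Otimes>\<^sub>M count_space UNIV)" if "t \<in> {0..T}" for t
    unfolding path_space_def using that by measurable
  have X [measurable]: "(\<lambda>p. (fst p, fst (snd p t))) \<in> measurable ?P (borel \<Otimes>\<^sub>M borel)"
    and I: "(\<lambda>p. snd (snd p t)) \<in> measurable ?P (count_space UNIV)" if "t \<in> {0..T}" for t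
    using ev[OF that] by measurable
  have regime: "(\<lambda>p. w (snd (snd p t)) p) \<in> borel_measurable ?P"
    if "t \<in> {0..T}" "\<And>i. w i \<in> borel_measurable ?P" for t and w :: "'m \<Rightarrow> _ \<Rightarrow> 'b::topological_space"
    using that(2) I[OF that(1)] by (rule measurable_compose_countable) 
  have V': "(\<lambda>p. V (fst p) t (fst (snd p t)) i) \<in> borel_measurable ?P" if "t \<in> {0..T}" for t i
    using measurable_compose[OF X[OF that] Vt[OF that]] by simp
  have G': "(\<lambda>p. param_gradient V (fst p) t (fst (snd p t)) i) \<in> borel_measurable ?P" if "t \<in> {0..T}" for t i
    using measurable_compose[OF X[OF that] Gt[OF that]] by simp
  have f': "(\<lambda>p. f t (fst (snd p t)) i) \<in> borel_measurable ?P" if "t \<in> {0..T}" for t i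
  proof -
    have "(\<lambda>p. fst (snd p t)) \<in> measurable ?P borel" using ev[OF that] by measurable
    from measurable_compose[OF this ft[OF that]] show ?thesis .
  qed
  have pol: "(\<lambda>p. parametrized_policy V g lam (fst p) t (fst (snd p t)) i j) \<in> borel_measurable ?P"
    if "t \<in> {0..T}" for t i j
    unfolding parametrized_policy_def using V'[OF that] by measurable
  have ent: "(\<lambda>p. entropy (parametrized_policy V g lam (fst p) t (fst (snd p t))) i) \<in> borel_measurable ?P"
    if "t \<in> {0..T}" for t i
    unfolding entropy_def using pol[OF that] by measurable
  show ?thesis
    unfolding case_prod_beta' Psi_def temporal_difference_def Let_def
  proof (intro borel_measurable_sum borel_measurable_scaleR borel_measurable_add borel_measurable_diff
      borel_measurable_times borel_measurable_const)
    fix k assume "k \<in> {..<K}"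
    then have t: "grid_time T K k \<in> {0..T}" and t': "grid_time T K (Suc k) \<in> {0..T}"
      using grid_time_mem assms by auto
    note regime[OF t V'[OF t]] regime[OF t' V'[OF t']] regime[OF t G'[OF t]]
      regime[OF t f'[OF t]] regime[OF t ent[OF t]]
    note this [measurable] I[OF t, measurable] I[OF t', measurable]
    show "(\<lambda>p. V (fst p) (grid_time T K (Suc k)) (fst (snd p (grid_time T K (Suc k)))) (snd (snd p (grid_time T K (Suc k))))) \<in> borel_measurable ?P"
      by measurable
    show "(\<lambda>p. V (fst p) (grid_time T K k) (fst (snd p (grid_time T K k))) (snd (snd p (grid_time T K k)))) \<in> borel_measurable ?P"
      by measurable
    show "(\<lambda>p. f (grid_time T K k) (fst (snd p (grid_time T K k))) (snd (snd p (grid_time T K k)))) \<in> borel_measurable ?P"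
      by measurable
    show "(\<lambda>p. entropy (parametrized_policy V g lam (fst p) (grid_time T K k) (fst (snd p (grid_time T K k)))) (snd (snd p (grid_time T K k)))) \<in> borel_measurable ?P"
      by measurable
    show "(\<lambda>p. g (snd (snd p (grid_time T K k))) (snd (snd p (grid_time T K (Suc k))))) \<in> borel_measurable ?P"
      by measurable
    show "(\<lambda>p. param_gradient V (fst p) (grid_time T K k) (fst (snd p (grid_time T K k))) (snd (snd p (grid_time T K k)))) \<in> borel_measurable ?P"
      by measurable
  qed
qed

section \<open>Mean square convergence of stochastic approximation\<close>

lemma (in prob_space) second_moment_of_conditional_bound:
  fixes X :: "'a \<Rightarrow> 'b::euclidean_space" and G :: "'a \<Rightarrow> 'c::euclidean_space"
  assumes X: "X \<in> borel_measurable M" and G: "G \<in> borel_measurable M" and C: "0 \<le> C"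
    and X2: "integrable M (\<lambda>\<omega>. (norm (X \<omega>))\<^sup>2)"
    and le: "AE \<omega> in M. nn_cond_exp M (vimage_algebra (space M) X borel) (\<lambda>\<omega>. ennreal ((norm (G \<omega>))\<^sup>2)) \<omega>
      \<le> ennreal (C * (1 + (norm (X \<omega>))\<^sup>2))"
  shows "integrable M (\<lambda>\<omega>. (norm (G \<omega>))\<^sup>2)"
    and "(\<integral>\<omega>. (norm (G \<omega>))\<^sup>2 \<partial>M) \<le> C * (1 + (\<integral>\<omega>. (norm (X \<omega>))\<^sup>2 \<partial>M))"
proof -
  note X [measurable] and G [measurable]
  have sub: "subalgebra M (vimage_algebra (space M) X borel)"
    unfolding subalgebra_def using X by (auto simp: sets_vimage_algebra2 intro: measurable_sets)
  interpret S: finite_measure_subalgebra M "vimage_algebra (space M) X borel" by standard (rule sub)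
  have "(\<integral>\<^sup>+\<omega>. ennreal ((norm (G \<omega>))\<^sup>2) \<partial>M)
      = (\<integral>\<^sup>+\<omega>. nn_cond_exp M (vimage_algebra (space M) X borel) (\<lambda>\<omega>. ennreal ((norm (G \<omega>))\<^sup>2)) \<omega> \<partial>M)"
    using S.nn_cond_exp_intg[of "\<lambda>_. 1" "\<lambda>\<omega>. ennreal ((norm (G \<omega>))\<^sup>2)"] by simp
  also have "\<dots> \<le> (\<integral>\<^sup>+\<omega>. ennreal (C * (1 + (norm (X \<omega>))\<^sup>2)) \<partial>M)"
    using le by (rule nn_integral_mono_AE)
  also have "\<dots> = ennreal (\<integral>\<omega>. C * (1 + (norm (X \<omega>))\<^sup>2) \<partial>M)"
    using X2 C by (intro nn_integral_eq_integral) auto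
  also have "(\<integral>\<omega>. C * (1 + (norm (X \<omega>))\<^sup>2) \<partial>M) = C * (1 + (\<integral>\<omega>. (norm (X \<omega>))\<^sup>2 \<partial>M))"
    using X2 by (simp add: prob_space)
  finally have bound: "(\<integral>\<^sup>+\<omega>. ennreal ((norm (G \<omega>))\<^sup>2) \<partial>M) \<le> ennreal (C * (1 + (\<integral>\<omega>. (norm (X \<omega>))\<^sup>2 \<partial>M)))" .
  then show int: "integrable M (\<lambda>\<omega>. (norm (G \<omega>))\<^sup>2)"
    by (intro integrableI_bounded) (auto simp: le_less_trans)
  have "ennreal (\<integral>\<omega>. (norm (G \<omega>))\<^sup>2 \<partial>M) \<le> ennreal (C * (1 + (\<integral>\<omega>. (norm (X \<omega>))\<^sup>2 \<partial>M)))"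
    using bound int by (subst (asm) nn_integral_eq_integral) auto
  then show "(\<integral>\<omega>. (norm (G \<omega>))\<^sup>2 \<partial>M) \<le> C * (1 + (\<integral>\<omega>. (norm (X \<omega>))\<^sup>2 \<partial>M))"
    using C by (simp add: ennreal_le_iff)
qed

lemma norm_add_square_le: "(norm (a + b :: 'b::real_inner))\<^sup>2 \<le> 2 * (norm a)\<^sup>2 + 2 * (norm b)\<^sup>2"
proof -
  have "(norm (a + b))\<^sup>2 + (norm (a - b))\<^sup>2 = 2 * (norm a)\<^sup>2 + 2 * (norm b)\<^sup>2"
    by (simp add: power2_norm_eq_inner inner_simps)
  then show ?thesis by (smt (verit) zero_le_power2)
qed

lemma abs_inner_le_squares: "\<bar>a \<bullet> b\<bar> \<le> (norm a)\<^sup>2 + (norm (b :: 'b::real_inner))\<^sup>2"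
proof -
  have "2 * (norm a * norm b) \<le> (norm a)\<^sup>2 + (norm b)\<^sup>2"
    using sum_squares_bound[of "norm a" "norm b"] by simp
  moreover have "\<bar>a \<bullet> b\<bar> \<le> norm a * norm b" by (rule Cauchy_Schwarz_ineq2)
  moreover have "0 \<le> norm a * norm b" by simp
  ultimately show ?thesis by linarith
qed

text \<open>The one-step estimate. The constant absorbs the shift of the origin to \<open>z\<close>, by
\<open>1 + \<bar>X\<bar>\<^sup>2 \<le> 2 (1 + \<bar>z\<bar>\<^sup>2) (1 + \<bar>X - z\<bar>\<^sup>2)\<close>.\<close>

lemma (in prob_space) mean_square_step:
  fixes X G :: "'a \<Rightarrow> 'b::euclidean_space"
  assumes [measurable]: "X \<in> borel_measurable M" "G \<in> borel_measurable M"
    and X2: "integrable M (\<lambda>\<omega>. (norm (X \<omega> - z))\<^sup>2)" and G2: "integrable M (\<lambda>\<omega>. (norm (G \<omega>))\<^sup>2)"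
    and C: "0 \<le> C" "(\<integral>\<omega>. (norm (G \<omega>))\<^sup>2 \<partial>M) \<le> C * (1 + (\<integral>\<omega>. (norm (X \<omega>))\<^sup>2 \<partial>M))"
    and drift: "(\<integral>\<omega>. (X \<omega> - z) \<bullet> G \<omega> \<partial>M) \<le> - \<kappa> * (\<integral>\<omega>. (norm (X \<omega> - z))\<^sup>2 \<partial>M)"
    and a: "0 \<le> a"
  defines "C' \<equiv> 2 * C * (1 + (norm z)\<^sup>2)"
  shows "integrable M (\<lambda>\<omega>. (norm (X \<omega> + a *\<^sub>R G \<omega> - z))\<^sup>2)"
    and "(\<integral>\<omega>. (norm (X \<omega> + a *\<^sub>R G \<omega> - z))\<^sup>2 \<partial>M)
      \<le> (1 - 2 * \<kappa> * a + C' * a\<^sup>2) * (\<integral>\<omega>. (norm (X \<omega> - z))\<^sup>2 \<partial>M) + C' * a\<^sup>2"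
proof -
  have expand: "(norm (X \<omega> + a *\<^sub>R G \<omega> - z))\<^sup>2
      = (norm (X \<omega> - z))\<^sup>2 + 2 * a * ((X \<omega> - z) \<bullet> G \<omega>) + a\<^sup>2 * (norm (G \<omega>))\<^sup>2" for \<omega>
  proof -
    have "(norm (u + w))\<^sup>2 = (norm u)\<^sup>2 + 2 * (u \<bullet> w) + (norm w)\<^sup>2" for u w :: 'b
      by (simp add: power2_norm_eq_inner inner_add_left inner_add_right inner_commute)
    from this[of "X \<omega> - z" "a *\<^sub>R G \<omega>"] show ?thesis
      by (simp add: power_mult_distrib add_diff_eq diff_add_eq)
  qed
  have XG: "integrable M (\<lambda>\<omega>. (X \<omega> - z) \<bullet> G \<omega>)"
    by (rule Bochner_Integration.integrable_bound[OF Bochner_Integration.integrable_add[OF X2 G2]])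
       (auto intro: abs_inner_le_squares)
  show "integrable M (\<lambda>\<omega>. (norm (X \<omega> + a *\<^sub>R G \<omega> - z))\<^sup>2)"
    unfolding expand using X2 G2 XG by auto
  have sq: "(norm (X \<omega>))\<^sup>2 \<le> 2 * (norm (X \<omega> - z))\<^sup>2 + 2 * (norm z)\<^sup>2" for \<omega>
    using norm_add_square_le[of "X \<omega> - z" z] by simp
  have "integrable M (\<lambda>\<omega>. 2 * (norm (X \<omega> - z))\<^sup>2 + 2 * (norm z)\<^sup>2)" using X2 by auto
  then have X02: "integrable M (\<lambda>\<omega>. (norm (X \<omega>))\<^sup>2)"
    by (rule Bochner_Integration.integrable_bound) (auto simp: sq)
  have "(\<integral>\<omega>. (norm (X \<omega>))\<^sup>2 \<partial>M) \<le> (\<integral>\<omega>. 2 * (norm (X \<omega> - z))\<^sup>2 + 2 * (norm z)\<^sup>2 \<partial>M)"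
    using X02 X2 sq by (intro integral_mono) auto
  also have "\<dots> = 2 * (\<integral>\<omega>. (norm (X \<omega> - z))\<^sup>2 \<partial>M) + 2 * (norm z)\<^sup>2"
    using X2 by (simp add: prob_space)
  finally have X0: "(\<integral>\<omega>. (norm (X \<omega>))\<^sup>2 \<partial>M) \<le> 2 * (\<integral>\<omega>. (norm (X \<omega> - z))\<^sup>2 \<partial>M) + 2 * (norm z)\<^sup>2" .
  let ?m = "\<integral>\<omega>. (norm (X \<omega> - z))\<^sup>2 \<partial>M"
  have m0: "0 \<le> ?m" by simp
  have "1 + (2 * ?m + 2 * (norm z)\<^sup>2) \<le> 2 * (1 + (norm z)\<^sup>2) * (1 + ?m)"
    using m0 by (simp add: algebra_simps)
  then have "C * (1 + (\<integral>\<omega>. (norm (X \<omega>))\<^sup>2 \<partial>M)) \<le> C * (2 * (1 + (norm z)\<^sup>2) * (1 + ?m))"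
    using X0 C(1) by (intro mult_left_mono) auto
  then have G': "(\<integral>\<omega>. (norm (G \<omega>))\<^sup>2 \<partial>M) \<le> C' * (1 + ?m)"
    using C(2) unfolding C'_def by (simp add: mult_ac)
  have "(\<integral>\<omega>. (norm (X \<omega> + a *\<^sub>R G \<omega> - z))\<^sup>2 \<partial>M)
      = ?m + 2 * a * (\<integral>\<omega>. (X \<omega> - z) \<bullet> G \<omega> \<partial>M) + a\<^sup>2 * (\<integral>\<omega>. (norm (G \<omega>))\<^sup>2 \<partial>M)"
    unfolding expand using X2 G2 XG by simp
  also have "\<dots> \<le> ?m + 2 * a * (- \<kappa> * ?m) + a\<^sup>2 * (C' * (1 + ?m))"
    using drift G' a by (intro add_mono mult_left_mono) auto
  also have "\<dots> = (1 - 2 * \<kappa> * a + C' * a\<^sup>2) * ?m + C' * a\<^sup>2" by (simp add: algebra_simps)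
  finally show "(\<integral>\<omega>. (norm (X \<omega> + a *\<^sub>R G \<omega> - z))\<^sup>2 \<partial>M)
      \<le> (1 - 2 * \<kappa> * a + C' * a\<^sup>2) * ?m + C' * a\<^sup>2" .
qed

text \<open>The rate for a general recursion driven by samples \<open>Y\<close>, whose law given the history \<open>H l\<close> is \<open>L\<close> at the current
iterate. Square integrability of the iterates is part of the claim: it is passed on from each iterate to the
next, and the one-step estimate makes sense only with it.\<close>

lemma (in prob_space) robbins_monro_mean_square_rate:
  fixes \<xi> :: "nat \<Rightarrow> 'a \<Rightarrow> 'b::euclidean_space" and \<Phi> :: "'b \<times> 'y \<Rightarrow> 'b"
  assumes sub: "\<And>l. l \<ge> 1 \<Longrightarrow> subalgebra M (H l)"
    and xi: "\<And>l. l \<ge> 1 \<Longrightarrow> \<xi> l \<in> borel_measurable (H l)"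
    and Y: "\<And>l. l \<ge> 1 \<Longrightarrow> Y (Suc l) \<in> measurable M P"
    and L: "\<And>\<zeta>. prob_space (L \<zeta>)" "\<And>\<zeta>. sets (L \<zeta>) = sets P"
    and cond: "\<And>l B. l \<ge> 1 \<Longrightarrow> B \<in> sets P \<Longrightarrow>
      AE \<omega> in M. real_cond_exp M (H l) (indicator (Y (Suc l) -` B \<inter> space M)) \<omega> = measure (L (\<xi> l \<omega>)) B"
    and \<Phi>: "\<Phi> \<in> borel_measurable (borel \<Otimes>\<^sub>M P)"
    and \<Phi>L: "\<And>\<zeta>. integrable (L \<zeta>) (\<lambda>y. \<Phi> (\<zeta>, y))"
    and drift: "\<And>\<zeta>. (\<zeta> - z) \<bullet> (\<integral>y. \<Phi> (\<zeta>, y) \<partial>L \<zeta>) \<le> - \<kappa> * (norm (\<zeta> - z))\<^sup>2"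
    and initial: "\<And>\<omega>. \<omega> \<in> space M \<Longrightarrow> \<xi> 1 \<omega> = start"
    and rec: "\<And>l \<omega>. l \<ge> 1 \<Longrightarrow> \<omega> \<in> space M \<Longrightarrow>
      \<xi> (Suc l) \<omega> = \<xi> l \<omega> + \<alpha> (Suc l) *\<^sub>R \<Phi> (\<xi> l \<omega>, Y (Suc l) \<omega>)"
    and C: "0 \<le> C"
    and second_moment: "\<And>l. l \<ge> 1 \<Longrightarrow> AE \<omega> in M.
      nn_cond_exp M (vimage_algebra (space M) (\<xi> l) borel)
        (\<lambda>\<omega>. ennreal ((norm (\<Phi> (\<xi> l \<omega>, Y (Suc l) \<omega>)))\<^sup>2)) \<omega>
      \<le> ennreal (C * (1 + (norm (\<xi> l \<omega>))\<^sup>2))"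
    and rate: "0 < \<nu>" "\<nu> \<le> 1" "0 < \<kappa>" "A > \<nu> / (2 * \<kappa>)" "0 < B"
      "\<And>l. l \<ge> 1 \<Longrightarrow> \<alpha> l = A / (real l powr \<nu> + B)"
  obtains D where "D > 0" "\<And>l. l \<ge> 1 \<Longrightarrow> integrable M (\<lambda>\<omega>. (norm (\<xi> l \<omega> - z))\<^sup>2)"
    "\<And>l. l \<ge> 1 \<Longrightarrow> (\<integral>\<omega>. (norm (\<xi> l \<omega> - z))\<^sup>2 \<partial>M) \<le> D * real l powr (- \<nu>)"
proof -
  define C' where "C' = 2 * C * (1 + (norm z)\<^sup>2)"
  have C': "0 \<le> C'" using C by (simp add: C'_def)
  have "0 < \<nu> / (2 * \<kappa>)" using rate by simp
  then have A: "A > 0" using rate(4) by linarith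
  have xiM: "\<xi> l \<in> borel_measurable M" if "l \<ge> 1" for l
    by (rule measurable_from_subalg[OF sub[OF that] xi[OF that]])
  have GM: "(\<lambda>\<omega>. \<Phi> (\<xi> l \<omega>, Y (Suc l) \<omega>)) \<in> borel_measurable M" if "l \<ge> 1" for l
    using xiM[OF that] Y[OF that] \<Phi> by measurable
  have one_step: "integrable M (\<lambda>\<omega>. (norm (\<xi> (Suc l) \<omega> - z))\<^sup>2) \<and>
      (\<integral>\<omega>. (norm (\<xi> (Suc l) \<omega> - z))\<^sup>2 \<partial>M)
        \<le> (1 - 2 * \<kappa> * \<alpha> (Suc l) + C' * (\<alpha> (Suc l))\<^sup>2) * (\<integral>\<omega>. (norm (\<xi> l \<omega> - z))\<^sup>2 \<partial>M) + C' * (\<alpha> (Suc l))\<^sup>2"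
    if l: "l \<ge> 1" and int: "integrable M (\<lambda>\<omega>. (norm (\<xi> l \<omega> - z))\<^sup>2)" for l
  proof -
    note [measurable] = xiM[OF l] GM[OF l]
    have "integrable M (\<lambda>\<omega>. 2 * (norm (\<xi> l \<omega> - z))\<^sup>2 + 2 * (norm z)\<^sup>2)" using int by auto
    then have X2: "integrable M (\<lambda>\<omega>. (norm (\<xi> l \<omega>))\<^sup>2)"
    proof (rule Bochner_Integration.integrable_bound)
      show "AE \<omega> in M. norm ((norm (\<xi> l \<omega>))\<^sup>2) \<le> norm (2 * (norm (\<xi> l \<omega> - z))\<^sup>2 + 2 * (norm z)\<^sup>2)"
        using norm_add_square_le[of "\<xi> l _ - z" z] by (intro AE_I2) simp
    qed measurable
    note G = second_moment_of_conditional_bound[OF xiM[OF l] GM[OF l] C X2 second_moment[OF l]]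
    have XG: "integrable M (\<lambda>\<omega>. (\<xi> l \<omega> - z) \<bullet> \<Phi> (\<xi> l \<omega>, Y (Suc l) \<omega>))"
      by (rule Bochner_Integration.integrable_bound[OF Bochner_Integration.integrable_add[OF int G(1)]])
         (auto intro: abs_inner_le_squares)
    have dr: "(\<integral>\<omega>. (\<xi> l \<omega> - z) \<bullet> \<Phi> (\<xi> l \<omega>, Y (Suc l) \<omega>) \<partial>M) \<le> - (\<integral>\<omega>. \<kappa> * (norm (\<xi> l \<omega> - z))\<^sup>2 \<partial>M)"
    proof (rule expectation_conditional_le[OF sub[OF l] xi[OF l] Y[OF l] L cond[OF l],
          where u="\<lambda>p. (fst p - z) \<bullet> \<Phi> p" and k="\<lambda>\<zeta>. \<kappa> * (norm (\<zeta> - z))\<^sup>2", simplified fst_conv])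
      show "(\<lambda>p. (fst p - z) \<bullet> \<Phi> p) \<in> borel_measurable (borel \<Otimes>\<^sub>M P)" using \<Phi> by measurable
      show "integrable (L \<zeta>) (\<lambda>y. (\<zeta> - z) \<bullet> \<Phi> (\<zeta>, y))" for \<zeta> using \<Phi>L by simp
      show "(\<integral>y. (\<zeta> - z) \<bullet> \<Phi> (\<zeta>, y) \<partial>L \<zeta>) \<le> - (\<kappa> * (norm (\<zeta> - z))\<^sup>2)" for \<zeta>
        using drift[of \<zeta>] \<Phi>L by simp
    qed (use rate XG int in auto)
    have \<alpha>0: "0 \<le> \<alpha> (Suc l)" using A rate by simp
    have dr': "(\<integral>\<omega>. (\<xi> l \<omega> - z) \<bullet> \<Phi> (\<xi> l \<omega>, Y (Suc l) \<omega>) \<partial>M)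
        \<le> - \<kappa> * (\<integral>\<omega>. (norm (\<xi> l \<omega> - z))\<^sup>2 \<partial>M)"
      using dr by simp
    have "integrable M (\<lambda>\<omega>. (norm (\<xi> l \<omega> + \<alpha> (Suc l) *\<^sub>R \<Phi> (\<xi> l \<omega>, Y (Suc l) \<omega>) - z))\<^sup>2) \<and>
      (\<integral>\<omega>. (norm (\<xi> l \<omega> + \<alpha> (Suc l) *\<^sub>R \<Phi> (\<xi> l \<omega>, Y (Suc l) \<omega>) - z))\<^sup>2 \<partial>M)
        \<le> (1 - 2 * \<kappa> * \<alpha> (Suc l) + C' * (\<alpha> (Suc l))\<^sup>2) * (\<integral>\<omega>. (norm (\<xi> l \<omega> - z))\<^sup>2 \<partial>M) + C' * (\<alpha> (Suc l))\<^sup>2"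
      unfolding C'_def
      using mean_square_step[OF xiM[OF l] GM[OF l] int G(1) C G(2) dr' \<alpha>0] by blast
    moreover have "(norm (\<xi> (Suc l) \<omega> - z))\<^sup>2 = (norm (\<xi> l \<omega> + \<alpha> (Suc l) *\<^sub>R \<Phi> (\<xi> l \<omega>, Y (Suc l) \<omega>) - z))\<^sup>2"
      if "\<omega> \<in> space M" for \<omega> using rec[OF l that] by simp
    ultimately show ?thesis
      by (simp cong: Bochner_Integration.integrable_cong Bochner_Integration.integral_cong)
  qed
  have int: "integrable M (\<lambda>\<omega>. (norm (\<xi> l \<omega> - z))\<^sup>2)" if "l \<ge> 1" for l
    using that
  proof (induction l rule: dec_induct)
    case base
    have "integrable M (\<lambda>_. (norm (start - z))\<^sup>2)" by simp
    then show ?case using initial by (simp cong: Bochner_Integration.integrable_cong)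
  next
    case (step l)
    then show ?case using one_step by simp
  qed
  obtain D where "D > 0" "\<And>l. l \<ge> 1 \<Longrightarrow> (\<integral>\<omega>. (norm (\<xi> l \<omega> - z))\<^sup>2 \<partial>M) \<le> D * real l powr (- \<nu>)"
    using recursion_powr_rate[OF rate(1-5) C' rate(6), of "\<lambda>l. \<integral>\<omega>. (norm (\<xi> l \<omega> - z))\<^sup>2 \<partial>M"] one_step int
    by metis
  then show ?thesis using that int by blast
qed

section \<open>Trajectories and their history\<close>

lemma trajectory_law_regime_diffusion:
  assumes "regime_diffusion 0 T \<mu> \<sigma> q init S"
  shows "prob_space (trajectory_law T S)" and "sets (trajectory_law T S) = sets (path_space T)"
proof -
  let ?M = "basis S"
  have fs: "filtered_space ?M (filt S)"
    and meas: "\<And>s. s \<in> {0..T} \<Longrightarrow> state S s \<in> borel_measurable (filt S s)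
      \<and> regime S s \<in> measurable (filt S s) (count_space UNIV)"
    using assms unfolding regime_diffusion_def Let_def by auto
  then have sub: "subalgebra ?M (filt S s)" for s by (simp add: filtered_space_def)
  interpret prob_space ?M using fs by (simp add: filtered_space_def)
  have "(\<lambda>\<omega>. \<lambda>s\<in>{0..T}. (state S s \<omega>, regime S s \<omega>)) \<in> measurable ?M (path_space T)"
    unfolding path_space_def
  proof (intro measurable_restrict measurable_Pair)
    fix s assume s: "s \<in> {0..T}"
    show "state S s \<in> borel_measurable ?M" "regime S s \<in> measurable ?M (count_space UNIV)"
      using meas[OF s] by (auto intro: measurable_from_subalg[OF sub[of s]])
  qed
  then show "prob_space (trajectory_law T S)"
    unfolding trajectory_law_def by (rule prob_space_distr)
  show "sets (trajectory_law T S) = sets (path_space T)" by (simp add: trajectory_law_def)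
qed

lemma sets_history:
  "sets (history M T Y l) = sigma_sets (space M)
    (\<Union>k\<in>{2..l}. {Y k -` B \<inter> space M | B. B \<in> sets (path_space T)})"
  unfolding history_def by (intro sets_measure_of) auto

lemma space_history [simp]: "space (history M T Y l) = space M"
  unfolding history_def by (intro space_measure_of) auto

lemma subalgebra_history:
  assumes "\<And>k. 2 \<le> k \<Longrightarrow> Y k \<in> measurable M (path_space T)"
  shows "subalgebra M (history M T Y l)"
  unfolding subalgebra_def sets_history using assms
  by (auto intro!: sets.sigma_sets_subset measurable_sets)

text \<open>Lets measurability with respect to the past be carried along the recursion.\<close>

lemma subalgebra_history_Suc: "subalgebra (history M T Y (Suc l)) (history M T Y l)"
  unfolding subalgebra_def sets_history by (intro conjI sigma_sets_mono' UN_mono) auto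

lemma measurable_history:
  assumes "2 \<le> k" "k \<le> l" "Y k \<in> measurable M (path_space T)"
  shows "Y k \<in> measurable (history M T Y l) (path_space T)"
proof (rule measurableI)
  show "Y k \<omega> \<in> space (path_space T)" if "\<omega> \<in> space (history M T Y l)" for \<omega>
    using that measurable_space[OF assms(3)] by simp
  show "Y k -` B \<inter> space (history M T Y l) \<in> sets (history M T Y l)" if "B \<in> sets (path_space T)" for B
    unfolding sets_history space_history using that assms(1,2) by (intro sigma_sets.Basic UN_I[of k]) auto
qed

lemma iterate_measurable_history:
  fixes \<xi> :: "nat \<Rightarrow> 'w \<Rightarrow> 'b::euclidean_space"
  assumes Y: "\<And>k. 2 \<le> k \<Longrightarrow> Y k \<in> measurable M (path_space T)"
    and \<Phi>: "(\<lambda>(\<zeta>, y). \<Phi> \<zeta> y) \<in> borel_measurable (borel \<Otimes>\<^sub>M path_space T)"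
    and initial: "\<And>\<omega>. \<omega> \<in> space M \<Longrightarrow> \<xi> 1 \<omega> = \<xi>1"
    and rec: "\<And>l \<omega>. l \<ge> 1 \<Longrightarrow> \<omega> \<in> space M \<Longrightarrow>
      \<xi> (Suc l) \<omega> = \<xi> l \<omega> + \<alpha> (Suc l) *\<^sub>R \<Phi> (\<xi> l \<omega>) (Y (Suc l) \<omega>)"
    and "1 \<le> l"
  shows "\<xi> l \<in> borel_measurable (history M T Y l)"
  using \<open>1 \<le> l\<close>
proof (induction l rule: dec_induct)
  case base
  \<comment> \<open>The first history is trivial: the first iterate is deterministic and the first trajectory has index \<open>2\<close>.\<close>
  have "(\<lambda>_. \<xi>1) \<in> borel_measurable (history M T Y 1)" by simp
  then show ?case using initial by (subst measurable_cong[where g="\<lambda>_. \<xi>1"]) auto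
next
  case (step l)
  let ?H = "history M T Y (Suc l)"
  have xi: "\<xi> l \<in> borel_measurable ?H"
    by (rule measurable_from_subalg[OF subalgebra_history_Suc step.IH])
  have "Y (Suc l) \<in> measurable ?H (path_space T)"
    using step Y by (intro measurable_history) auto
  then have "(\<lambda>\<omega>. (\<xi> l \<omega>, Y (Suc l) \<omega>)) \<in> measurable ?H (borel \<Otimes>\<^sub>M path_space T)"
    using xi by measurable
  from measurable_compose[OF this \<Phi>]
  have "(\<lambda>\<omega>. \<Phi> (\<xi> l \<omega>) (Y (Suc l) \<omega>)) \<in> borel_measurable ?H" by simp
  then have "(\<lambda>\<omega>. \<xi> l \<omega> + \<alpha> (Suc l) *\<^sub>R \<Phi> (\<xi> l \<omega>) (Y (Suc l) \<omega>)) \<in> borel_measurable ?H"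
    using xi by measurable
  then show ?case using rec step(1) by (subst measurable_cong) auto
qed

section \<open>Supremum norms and the tail estimate\<close>

lemma sup_norm_diff_triangle:
  "sup_norm T (\<lambda>t x. u t x - w t x)
    \<le> sup_norm T (\<lambda>t x. w t x - r t x) + sup_norm T (\<lambda>t x. u t x - r t x)"
  unfolding sup_norm_def
proof (rule SUP_least, clarify)
  fix t :: real and x assume t: "t \<in> {0..T}"
  have "ennreal \<bar>u t x - w t x\<bar> \<le> ennreal (\<bar>w t x - r t x\<bar> + \<bar>u t x - r t x\<bar>)"
    by (intro ennreal_leI) linarith
  also have "\<dots> = ennreal \<bar>w t x - r t x\<bar> + ennreal \<bar>u t x - r t x\<bar>" by (simp add: ennreal_plus)
  also have "\<dots> \<le> (SUP (t, x)\<in>{0..T} \<times> UNIV. ennreal \<bar>w t x - r t x\<bar>)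
      + (SUP (t, x)\<in>{0..T} \<times> UNIV. ennreal \<bar>u t x - r t x\<bar>)"
    using t by (intro add_mono SUP_upper2[of "(t, x)"]) auto
  finally show "ennreal \<bar>u t x - w t x\<bar> \<le> \<dots>" .
qed

lemma SUP_sup_norm_diff_triangle:
  "(SUP j. sup_norm T (\<lambda>t x. u t x j - w t x j))
    \<le> (SUP j. sup_norm T (\<lambda>t x. w t x j - r t x j)) + (SUP j. sup_norm T (\<lambda>t x. u t x j - r t x j))"
proof (rule SUP_least)
  fix j
  have "sup_norm T (\<lambda>t x. u t x j - w t x j)
    \<le> sup_norm T (\<lambda>t x. w t x j - r t x j) + sup_norm T (\<lambda>t x. u t x j - r t x j)"
    by (rule sup_norm_diff_triangle)
  also have "\<dots> \<le> (SUP j. sup_norm T (\<lambda>t x. w t x j - r t x j)) + (SUP j. sup_norm T (\<lambda>t x. u t x j - r t x j))"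
    by (intro add_mono SUP_upper) auto
  finally show "sup_norm T (\<lambda>t x. u t x j - w t x j) \<le> \<dots>" .
qed

text \<open>A sublevel set of a supremum of continuous functions of the parameter is an intersection of closed sets,
however many points \<open>t\<close> and \<open>x\<close> the supremum runs over. The event of the main result is a preimage of such a set.\<close>

lemma closed_sup_norm_le:
  fixes V :: "'z::topological_space \<Rightarrow> real \<Rightarrow> real ^ 'n \<Rightarrow> 'm \<Rightarrow> real"
  assumes "\<And>t x j. t \<in> {0..T} \<Longrightarrow> continuous_on UNIV (\<lambda>\<zeta>. V \<zeta> t x j)"
  shows "closed {\<zeta>. (SUP j. sup_norm T (\<lambda>t x. V \<zeta> t x j - v t x j)) \<le> c}"
proof -
  have "{\<zeta>. (SUP j. sup_norm T (\<lambda>t x. V \<zeta> t x j - v t x j)) \<le> c}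
      = (\<Inter>j. \<Inter>t\<in>{0..T}. \<Inter>x. {\<zeta>. ennreal \<bar>V \<zeta> t x j - v t x j\<bar> \<le> c})"
    by (auto simp: sup_norm_def SUP_le_iff)
  also have "closed \<dots>"
  proof (intro closed_INT ballI closed_Collect_le continuous_on_const)
    fix t x j assume "t \<in> {0..T}"
    then show "continuous_on UNIV (\<lambda>\<zeta>. ennreal \<bar>V \<zeta> t x j - v t x j\<bar>)"
      by (intro continuous_on_ennreal continuous_on_rabs continuous_on_diff assms continuous_on_const)
  qed
  finally show ?thesis .
qed

lemma (in prob_space) second_moment_tail:
  assumes "X \<in> borel_measurable M" "integrable M (\<lambda>\<omega>. (norm (X \<omega> :: 'b::euclidean_space))\<^sup>2)"
    and "(\<integral>\<omega>. (norm (X \<omega>))\<^sup>2 \<partial>M) \<le> b" "0 < b" "0 < \<epsilon>"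
  shows "1 - \<epsilon> \<le> measure M {\<omega> \<in> space M. (norm (X \<omega>))\<^sup>2 < b / \<epsilon>}"
proof -
  note [measurable] = assms(1)
  have "measure M {\<omega> \<in> space M. (norm (X \<omega>))\<^sup>2 \<ge> b / \<epsilon>} \<le> (\<integral>\<omega>. (norm (X \<omega>))\<^sup>2 \<partial>M) / (b / \<epsilon>)"
    using assms by (intro integral_Markov_inequality_measure[where A="{}"]) auto
  also have "\<dots> \<le> \<epsilon>" using assms by (simp add: field_simps)
  also have "{\<omega> \<in> space M. (norm (X \<omega>))\<^sup>2 \<ge> b / \<epsilon>} = space M - {\<omega> \<in> space M. (norm (X \<omega>))\<^sup>2 < b / \<epsilon>}"
    by auto
  also have "measure M \<dots> = 1 - measure M {\<omega> \<in> space M. (norm (X \<omega>))\<^sup>2 < b / \<epsilon>}"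
    by (rule prob_compl) measurable
  finally show ?thesis by simp
qed

lemma powr_le_of_square_less:
  fixes r :: real
  assumes "0 \<le> r" "r\<^sup>2 < D * a / \<epsilon>" "0 < D" "0 < a" "0 < \<epsilon>" "0 < \<rho>"
  shows "r powr \<rho> \<le> D powr (\<rho> / 2) / \<epsilon> powr (\<rho> / 2) * a powr (\<rho> / 2)"
proof -
  have "r \<le> (D * a / \<epsilon>) powr (1 / 2)"
    using assms by (simp add: powr_half_sqrt real_le_rsqrt)
  then have "r powr \<rho> \<le> ((D * a / \<epsilon>) powr (1 / 2)) powr \<rho>"
    using assms by (intro powr_mono2) auto
  also have "\<dots> = D powr (\<rho> / 2) / \<epsilon> powr (\<rho> / 2) * a powr (\<rho> / 2)"
    using assms by (simp add: powr_powr powr_mult powr_divide)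
  finally show ?thesis .
qed

section \<open>Error bound for the learned value function\<close>

theorem theorem5p4:
  fixes T :: real and K :: nat and lam :: real
    and \<mu> :: "real \<Rightarrow> real ^ 'n \<Rightarrow> 'm::finite \<Rightarrow> real ^ 'n"
    and \<sigma> :: "real \<Rightarrow> real ^ 'n \<Rightarrow> 'm \<Rightarrow> real ^ 'd ^ 'n"
    and f :: "real \<Rightarrow> real ^ 'n \<Rightarrow> 'm \<Rightarrow> real"
    and h :: "real ^ 'n \<Rightarrow> real"
    and g :: "'m \<Rightarrow> 'm \<Rightarrow> real"
    and \<pi> :: "real \<Rightarrow> real ^ 'n \<Rightarrow> 'm \<Rightarrow> 'm \<Rightarrow> real"
    and S :: "real \<Rightarrow> real ^ 'n \<Rightarrow> 'm \<Rightarrow> ('s, 'd, 'n, 'm) weak_solution"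
    and v :: "real \<Rightarrow> real ^ 'n \<Rightarrow> 'm \<Rightarrow> real"
    and V :: "real ^ 'l \<Rightarrow> real \<Rightarrow> real ^ 'n \<Rightarrow> 'm \<Rightarrow> real"
    and init :: "((real ^ 'n) \<times> 'm) measure"
    and Z :: "real ^ 'l \<Rightarrow> ('z, 'd, 'n, 'm) weak_solution"
    and \<psi> :: "real ^ 'l \<Rightarrow> real ^ 'l"
    and M :: "'w measure"
    and Y :: "nat \<Rightarrow> 'w \<Rightarrow> ('n, 'm) path"
    and \<xi> :: "nat \<Rightarrow> 'w \<Rightarrow> real ^ 'l"
    and \<xi>1 \<xi>star :: "real ^ 'l"
    and \<alpha> :: "nat \<Rightarrow> real"
    and \<kappa> \<rho> \<nu> A B :: real
  assumes model: "T > 0" "K > 0" "lam > 0" "\<And>i. g i i = 0"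
      "\<And>i. (\<lambda>(t, x). f t x i) \<in> borel_measurable (restrict_space borel ({0..T} \<times> UNIV))"
    and evaluated_policy: "feedback_policy T \<pi>"
    and value_fn: "is_value_function T \<mu> \<sigma> f h g lam \<pi> S v"
    and param_measurable:
      "\<And>\<zeta> i. (\<lambda>(t, x). V \<zeta> t x i) \<in> borel_measurable (restrict_space borel ({0..T} \<times> UNIV))"
    and param_differentiable:
      "\<And>\<zeta> t x i. t \<in> {0..T} \<Longrightarrow> (\<lambda>\<theta>. V \<theta> t x i) differentiable (at \<zeta>)"
    and param_terminal: "\<And>\<zeta> x i. V \<zeta> T x i = h x"
    and trajectories:
      "\<And>\<zeta>. regime_diffusion 0 T \<mu> \<sigma> (parametrized_policy V g lam \<zeta>) init (Z \<zeta>)"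
    and Psi_integrable:
      "\<And>\<zeta>. integrable (trajectory_law T (Z \<zeta>)) (Psi T K f g lam V \<zeta>)"
    and psi: "\<And>\<zeta>. \<psi> \<zeta> = (\<integral>y. Psi T K f g lam V \<zeta> y \<partial>trajectory_law T (Z \<zeta>))"
    and prob: "prob_space M"
    and sampling: "samples_trajectories M T (\<lambda>\<zeta>. trajectory_law T (Z \<zeta>)) \<xi> Y"
    and initial: "\<And>\<omega>. \<omega> \<in> space M \<Longrightarrow> \<xi> 1 \<omega> = \<xi>1"
    and recursion: "\<And>l \<omega>. l \<ge> 1 \<Longrightarrow> \<omega> \<in> space M \<Longrightarrow>
        \<xi> (Suc l) \<omega> = \<xi> l \<omega> + \<alpha> (Suc l) *\<^sub>R Psi T K f g lam V (\<xi> l \<omega>) (Y (Suc l) \<omega>)"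
    and i: "stable_equilibrium \<psi> \<xi>star" "\<And>z. stable_equilibrium \<psi> z \<Longrightarrow> z = \<xi>star"
    and ii: "\<exists>C>0. \<forall>l\<ge>1. AE \<omega> in M.
        nn_cond_exp M (vimage_algebra (space M) (\<xi> l) borel)
          (\<lambda>\<omega>. ennreal ((norm (Psi T K f g lam V (\<xi> l \<omega>) (Y (Suc l) \<omega>)))\<^sup>2)) \<omega>
        \<le> ennreal (C * (1 + (norm (\<xi> l \<omega>))\<^sup>2))"
    and iii: "\<kappa> > 0" "\<And>\<zeta>. (\<zeta> - \<xi>star) \<bullet> \<psi> \<zeta> \<le> - \<kappa> * (norm (\<zeta> - \<xi>star))\<^sup>2"
    and iv: "\<rho> > 0" "\<exists>C>0. \<forall>\<zeta>.
        (SUP j. sup_norm T (\<lambda>t x. V \<zeta> t x j - V \<xi>star t x j))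
        \<le> ennreal (C * norm (\<zeta> - \<xi>star) powr \<rho>)"
    and learning_rate: "0 < \<nu>" "\<nu> \<le> 1" "A > \<nu> / (2 * \<kappa>)" "B > 0"
      "\<And>l. l \<ge> 1 \<Longrightarrow> \<alpha> l = A / (real l powr \<nu> + B)"
  shows "\<exists>C>0. \<forall>\<epsilon>>0. \<forall>l\<ge>1.
    measure M {\<omega> \<in> space M.
        (SUP j. sup_norm T (\<lambda>t x. V (\<xi> l \<omega>) t x j - v t x j))
        \<le> (SUP j. sup_norm T (\<lambda>t x. v t x j - V \<xi>star t x j))
           + ennreal (C / \<epsilon> powr (\<rho> / 2) * real l powr (- (\<nu> * \<rho> / 2)))}
    \<ge> 1 - \<epsilon>"
proof -
  interpret prob_space M by (rule prob)
  let ?\<Phi> = "\<lambda>p. Psi T K f g lam V (fst p) (snd p)"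
  let ?e = "\<lambda>\<zeta>. SUP j. sup_norm T (\<lambda>t x. V \<zeta> t x j - V \<xi>star t x j)"
  let ?d = "SUP j. sup_norm T (\<lambda>t x. v t x j - V \<xi>star t x j)"
  have \<Phi>: "(\<lambda>(\<zeta>, y). Psi T K f g lam V \<zeta> y) \<in> borel_measurable (borel \<Otimes>\<^sub>M path_space T)"
    by (rule borel_measurable_Psi[OF model(1,2,5) param_measurable param_differentiable])
  have Y: "Y (Suc l) \<in> measurable M (path_space T)" if "l \<ge> 1" for l
    using sampling that by (auto simp: samples_trajectories_def)
  have Y2: "Y k \<in> measurable M (path_space T)" if "2 \<le> k" for k
    using Y[of "k - 1"] that by simp
  have xi: "\<xi> l \<in> borel_measurable (history M T Y l)" if "l \<ge> 1" for l
    by (rule iterate_measurable_history[OF Y2 \<Phi> initial recursion that])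
  have xiM: "\<xi> l \<in> borel_measurable M" if "l \<ge> 1" for l
    by (rule measurable_from_subalg[OF subalgebra_history[OF Y2] xi[OF that]])
  obtain C2 where C2: "C2 > 0" and second: "\<And>l. l \<ge> 1 \<Longrightarrow> AE \<omega> in M.
        nn_cond_exp M (vimage_algebra (space M) (\<xi> l) borel)
          (\<lambda>\<omega>. ennreal ((norm (Psi T K f g lam V (\<xi> l \<omega>) (Y (Suc l) \<omega>)))\<^sup>2)) \<omega>
        \<le> ennreal (C2 * (1 + (norm (\<xi> l \<omega>))\<^sup>2))"
    using ii by blast
  obtain D where D: "D > 0"
    and int: "\<And>l. l \<ge> 1 \<Longrightarrow> integrable M (\<lambda>\<omega>. (norm (\<xi> l \<omega> - \<xi>star))\<^sup>2)"
    and ms: "\<And>l. l \<ge> 1 \<Longrightarrow> (\<integral>\<omega>. (norm (\<xi> l \<omega> - \<xi>star))\<^sup>2 \<partial>M) \<le> D * real l powr (- \<nu>)"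
  proof (rule robbins_monro_mean_square_rate[where H="history M T Y" and \<xi>=\<xi> and Y=Y
        and P="path_space T" and L="\<lambda>\<zeta>. trajectory_law T (Z \<zeta>)" and \<Phi>="?\<Phi>" and z=\<xi>star
        and \<alpha>=\<alpha> and \<kappa>=\<kappa> and \<nu>=\<nu> and A=A and B=B and C=C2 and start=\<xi>1])
    show "subalgebra M (history M T Y l)" for l by (rule subalgebra_history[OF Y2])
    show "AE \<omega> in M. real_cond_exp M (history M T Y l) (indicator (Y (Suc l) -` B' \<inter> space M)) \<omega>
        = measure (trajectory_law T (Z (\<xi> l \<omega>))) B'" if "l \<ge> 1" "B' \<in> sets (path_space T)" for l B'
      using sampling that by (auto simp: samples_trajectories_def)
    show "(\<zeta> - \<xi>star) \<bullet> (\<integral>y. ?\<Phi> (\<zeta>, y) \<partial>trajectory_law T (Z \<zeta>)) \<le> - \<kappa> * (norm (\<zeta> - \<xi>star))\<^sup>2" for \<zeta>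
      using iii(2)[of \<zeta>] by (simp add: psi)
  qed (use xi Y trajectory_law_regime_diffusion[OF trajectories] \<Phi> Psi_integrable initial recursion C2 second
      learning_rate iii(1) in \<open>simp_all add: case_prod_beta'\<close>)
  obtain C4 where C4: "C4 > 0" and hoelder: "\<And>\<zeta>. ?e \<zeta> \<le> ennreal (C4 * norm (\<zeta> - \<xi>star) powr \<rho>)"
    using iv(2) by blast
  have cont: "continuous_on UNIV (\<lambda>\<zeta>. V \<zeta> t x j)" if "t \<in> {0..T}" for t x j
    using param_differentiable[OF that]
    by (auto simp: continuous_on_eq_continuous_at intro: differentiable_imp_continuous_within)
  show ?thesis
  proof (intro exI[of _ "C4 * D powr (\<rho> / 2)"] conjI allI impI)
    show "0 < C4 * D powr (\<rho> / 2)" using C4 D by simp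
    fix \<epsilon> :: real and l :: nat assume \<epsilon>: "0 < \<epsilon>" and l: "1 \<le> l"
    let ?b = "?d + ennreal (C4 * D powr (\<rho> / 2) / \<epsilon> powr (\<rho> / 2) * real l powr (- (\<nu> * \<rho> / 2)))"
    let ?E = "{\<omega> \<in> space M. (SUP j. sup_norm T (\<lambda>t x. V (\<xi> l \<omega>) t x j - v t x j)) \<le> ?b}"
    note [measurable] = xiM[OF l]
    have "1 - \<epsilon> \<le> measure M {\<omega> \<in> space M. (norm (\<xi> l \<omega> - \<xi>star))\<^sup>2 < D * real l powr (- \<nu>) / \<epsilon>}"
      using D \<epsilon> l by (intro second_moment_tail int ms) auto
    also have "\<dots> \<le> measure M ?E"
    proof (rule finite_measure_mono)
      show "{\<omega> \<in> space M. (norm (\<xi> l \<omega> - \<xi>star))\<^sup>2 < D * real l powr (- \<nu>) / \<epsilon>} \<subseteq> ?E"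
      proof safe
        fix \<omega> assume "(norm (\<xi> l \<omega> - \<xi>star))\<^sup>2 < D * real l powr (- \<nu>) / \<epsilon>"
        then have "norm (\<xi> l \<omega> - \<xi>star) powr \<rho>
            \<le> D powr (\<rho> / 2) / \<epsilon> powr (\<rho> / 2) * (real l powr (- \<nu>)) powr (\<rho> / 2)"
          using D \<epsilon> l iv(1) by (intro powr_le_of_square_less) auto
        then have "C4 * norm (\<xi> l \<omega> - \<xi>star) powr \<rho>
            \<le> C4 * (D powr (\<rho> / 2) / \<epsilon> powr (\<rho> / 2) * (real l powr (- \<nu>)) powr (\<rho> / 2))"
          using C4 by (intro mult_left_mono) auto
        also have "\<dots> = C4 * D powr (\<rho> / 2) / \<epsilon> powr (\<rho> / 2) * real l powr (- (\<nu> * \<rho> / 2))"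
          by (simp add: powr_powr)
        finally have "?e (\<xi> l \<omega>)
            \<le> ennreal (C4 * D powr (\<rho> / 2) / \<epsilon> powr (\<rho> / 2) * real l powr (- (\<nu> * \<rho> / 2)))"
          using hoelder[of "\<xi> l \<omega>"] by (meson ennreal_leI order_trans)
        then show "(SUP j. sup_norm T (\<lambda>t x. V (\<xi> l \<omega>) t x j - v t x j)) \<le> ?b"
          using SUP_sup_norm_diff_triangle[of T "V (\<xi> l \<omega>)" v "V \<xi>star"] by (meson add_left_mono order_trans)
      qed
      have "?E = \<xi> l -` {\<zeta>. (SUP j. sup_norm T (\<lambda>t x. V \<zeta> t x j - v t x j)) \<le> ?b} \<inter> space M" by auto
      also have "\<dots> \<in> sets M"
        by (rule measurable_sets[OF xiM[OF l] borel_closed[OF closed_sup_norm_le[OF cont]]])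
      finally show "?E \<in> sets M" .
    qed
    finally show "1 - \<epsilon> \<le> measure M ?E" .
  qed
qed

end
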